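(* For any Boolean-valued function $f$ with $\mathrm{Dom}(f)\subseteq\Sigma^n$ ($\Sigma$ finite) and any $\gamma\in(0,1/3)$, \[\mathrm{PQ}_{(1-\gamma)/2}(f)=O(\gamma\,\mathrm{Q}(f))\quad\text{and}\quad\mathrm{PQ}_{(1-\gamma)/2}(f)=\Omega\!\left(\frac{\gamma\,\mathrm{Q}(f)}{\log(1/\gamma)\log\log(1/\gamma)}\right),\] with universal constants.
   Context: A probabilistic quantum algorithm $P$ is a probability distribution over quantum query algorithms; its cost $|P|$ is the expected number of queries of a quantum algorithm sampled from $P$, and on input $x$ it outputs $Q(x)$ for $Q\sim P$. $\mathrm{PQ}_{(1-\gamma)/2}(f)$ is the minimum cost of a probabilistic quantum algorithm with worst-case bias at least $\gamma$, i.e. error probability at most $(1-\gamma)/2$ on every $x\in\mathrm{Dom}(f)$. $\mathrm{Q}(f)$ is the minimum number of queries of a quantum algorithm with error at most $1/3$ on every input. *)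

theory Defs
  imports "HOL-Probability.Probability" "Jordan_Normal_Form.Schur_Decomposition"
begin

text \<open>
  The alphabet of size \<open>k\<close> is \<open>{..<k}\<close>, a string of length \<open>n\<close> is a list, and a partial
  Boolean-valued function is a map \<open>nat list \<rightharpoonup> bool\<close>.  Taking one fixed type of letters, rather
  than a type variable, is what makes constants that are chosen before \<open>k\<close> and \<open>n\<close> universal.
\<close>

definition strings :: "nat \<Rightarrow> nat \<Rightarrow> nat list set" where
  "strings k n = {x. set x \<subseteq> {..<k} \<and> length x = n}"

text \<open>
  The state space of an algorithm is spanned by the basis states \<open>|i, b, w\<rangle>\<close> with \<open>i \<le> n\<close>
  (index register), \<open>b < k\<close> (answer register) and \<open>w < m\<close> (workspace), enumerated
  lexicographically.  The index \<open>n\<close> is the usual null query, on which the oracle acts trivially.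
\<close>

definition basis_index :: "nat \<Rightarrow> nat \<Rightarrow> nat \<Rightarrow> nat \<Rightarrow> nat \<Rightarrow> nat" where
  "basis_index k m i b w = (i * k + b) * m + w"

definition qdim :: "nat \<Rightarrow> nat \<Rightarrow> nat \<Rightarrow> nat" where
  "qdim k n m = Suc n * k * m"

text \<open>
  The oracle \<open>|i, b, w\<rangle> \<mapsto> |i, (b + x\<^sub>i) mod k, w\<rangle>\<close>; the registers \<open>i, b, w\<close> are decoded from the
  column index \<open>c\<close>.
\<close>

definition oracle_mat :: "nat \<Rightarrow> nat \<Rightarrow> nat \<Rightarrow> nat list \<Rightarrow> complex mat" where
  "oracle_mat k n m x = Matrix.mat (qdim k n m) (qdim k n m) (\<lambda>(r, c).
     let i = c div (k * m); b = c div m mod k; w = c mod m;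
         b' = (if i < n then (b + x ! i) mod k else b)
     in if r = basis_index k m i b' w then 1 else 0)"

definition unitary_mat :: "nat \<Rightarrow> complex mat \<Rightarrow> bool" where
  "unitary_mat d U \<longleftrightarrow>
     U \<in> carrier_mat d d \<and> mat_adjoint U * U = 1\<^sub>m d \<and> U * mat_adjoint U = 1\<^sub>m d"

text \<open>
  An algorithm making \<open>T\<close> queries is \<open>U\<^sub>T O\<^sub>x \<dots> U\<^sub>1 O\<^sub>x U\<^sub>0\<close>, applied to the first basis state and
  followed by a measurement in the standard basis.  Here \<open>U\<^sub>0\<close> is \<open>alg_init\<close>, and
  \<open>[U\<^sub>1, \<dots>, U\<^sub>T]\<close> is \<open>alg_rounds\<close>.  The output is \<open>True\<close> iff the measured basis state lies
  in \<open>alg_accept\<close>.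
\<close>

record query_alg =
  alg_work :: nat
  alg_init :: "complex mat"
  alg_rounds :: "complex mat list"
  alg_accept :: "nat set"

definition query_alg :: "nat \<Rightarrow> nat \<Rightarrow> query_alg \<Rightarrow> bool" where
  "query_alg k n A \<longleftrightarrow> alg_work A > 0 \<and>
     (\<forall>U \<in> insert (alg_init A) (set (alg_rounds A)). unitary_mat (qdim k n (alg_work A)) U)"

definition queries :: "query_alg \<Rightarrow> nat" where
  "queries A = length (alg_rounds A)"

definition final_state :: "nat \<Rightarrow> nat \<Rightarrow> query_alg \<Rightarrow> nat list \<Rightarrow> complex Matrix.vec" where
  "final_state k n A x =
     foldl (\<lambda>v U. U *\<^sub>v (oracle_mat k n (alg_work A) x *\<^sub>v v))
       (alg_init A *\<^sub>v unit_vec (qdim k n (alg_work A)) 0) (alg_rounds A)"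

definition accept_prob :: "nat \<Rightarrow> nat \<Rightarrow> query_alg \<Rightarrow> nat list \<Rightarrow> real" where
  "accept_prob k n A x =
     (\<Sum>j \<in> alg_accept A \<inter> {..<qdim k n (alg_work A)}. (cmod (vec_index (final_state k n A x) j))\<^sup>2)"

text \<open>
  \<open>bernoulli_pmf\<close> truncates its argument to the unit interval, which has no effect here: the final
  state of a \<open>query_alg\<close> on a string over the alphabet is a unit vector.
\<close>

definition alg_output :: "nat \<Rightarrow> nat \<Rightarrow> query_alg \<Rightarrow> nat list \<Rightarrow> bool pmf" where
  "alg_output k n A x = bernoulli_pmf (accept_prob k n A x)"

definition computes :: "(nat list \<Rightarrow> bool pmf) \<Rightarrow> real \<Rightarrow> (nat list \<rightharpoonup> bool) \<Rightarrow> bool" where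
  "computes out \<epsilon> f \<longleftrightarrow>
     (\<forall>x \<in> dom f. measure_pmf.prob (out x) {y. Some y \<noteq> f x} \<le> \<epsilon>)"

definition Q :: "nat \<Rightarrow> nat \<Rightarrow> (nat list \<rightharpoonup> bool) \<Rightarrow> nat" where
  "Q k n f = (LEAST T. \<exists>A. query_alg k n A \<and> computes (alg_output k n A) (1/3) f \<and> queries A = T)"

definition prob_query_alg :: "nat \<Rightarrow> nat \<Rightarrow> query_alg pmf \<Rightarrow> bool" where
  "prob_query_alg k n P \<longleftrightarrow> (\<forall>A \<in> set_pmf P. query_alg k n A)"

definition cost :: "query_alg pmf \<Rightarrow> ennreal" where
  "cost P = (\<integral>\<^sup>+A. of_nat (queries A) \<partial>measure_pmf P)"

definition prob_output :: "nat \<Rightarrow> nat \<Rightarrow> query_alg pmf \<Rightarrow> nat list \<Rightarrow> bool pmf" where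
  "prob_output k n P x = bind_pmf P (\<lambda>A. alg_output k n A x)"

definition PQ :: "nat \<Rightarrow> nat \<Rightarrow> real \<Rightarrow> (nat list \<rightharpoonup> bool) \<Rightarrow> ennreal" where
  "PQ k n \<epsilon> f = Inf {cost P | P. prob_query_alg k n P \<and> computes (prob_output k n P) \<epsilon> f}"

end

theory Submission
  imports Defs
begin

text \<open>
  Upper bound: run an optimal algorithm with probability \<open>3\<gamma>\<close> and toss a fair coin otherwise.

  Lower bound: let \<open>P\<close> have cost \<open>C\<close> and bias \<open>\<gamma>\<close>, and sort the algorithms in \<open>P\<close> into levels according
  to the least \<open>j\<close> with at most \<open>2\<^sup>j C\<close> queries. By Markov's inequality, dropping all levels beyond
  some \<open>L = O(log (1/\<gamma>))\<close> changes the bias by at most \<open>\<gamma>/8\<close>. What is left of the bias is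
  \<open>\<Sum>\<^sub>j w\<^sub>j b\<^sub>j\<close>, where \<open>w\<^sub>j\<close> is the weight of level \<open>j\<close> and \<open>b\<^sub>j\<close> the bias of the corresponding
  mixture, and \<open>\<Sum>\<^sub>j w\<^sub>j 2\<^sup>j C = O(C)\<close>. Quantum estimation of \<open>b\<^sub>j\<close> up to \<open>\<epsilon> / w\<^sub>j\<close> with failure probability
  \<open>\<delta>\<close> costs \<open>O(2\<^sup>j C w\<^sub>j log (1/\<delta>) / \<epsilon>)\<close> queries. With \<open>\<epsilon> = \<gamma> / (2 (L + 1))\<close> and \<open>\<delta>\<close> of order \<open>1 / L\<close>
  the sign of the sum is found with \<open>O(C L log L / \<gamma>)\<close> queries.

  Estimation: from a \<open>T\<close>-query algorithm of bias \<open>cos \<theta>\<close>, amplitude amplification makes an \<open>N T\<close>-query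
  algorithm of bias \<open>cos (N \<theta>)\<close>, for odd \<open>N\<close>. Mixing with a coin first moves the centre of an interval
  of radius \<open>l\<close> known to contain the bias to \<open>\<theta> = \<pi>/2\<close>; with \<open>N\<close> of order \<open>1 / l\<close>, a majority vote
  then cuts off a third of the interval.
\<close>

section \<open>Matrices\<close>

lemma dim_mat_adjoint [simp]:
  "dim_row (mat_adjoint A) = dim_col A" "dim_col (mat_adjoint A) = dim_row A"
  by (simp_all add: mat_adjoint_def)

lemma mat_adjoint_carrier [simp]:
  "A \<in> carrier_mat a b \<Longrightarrow> mat_adjoint A \<in> carrier_mat b a"
  by (auto intro!: carrier_matI)

lemma index_mat_adjoint [simp]:
  fixes A :: "complex mat"
  assumes "i < dim_col A" "j < dim_row A"
  shows "mat_adjoint A $$ (i, j) = cnj (A $$ (j, i))"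
  using assms by (simp add: mat_adjoint_def mat_of_rows_index)

lemma index_mult_mat_sum:
  fixes A B :: "'a :: comm_semiring_0 mat"
  assumes "A \<in> carrier_mat a b" "B \<in> carrier_mat b c" "i < a" "j < c"
  shows "(A * B) $$ (i, j) = (\<Sum>h<b. A $$ (i, h) * B $$ (h, j))"
  using assms by (auto simp: scalar_prod_def atLeast0LessThan intro!: sum.cong)

lemma mat_adjoint_mult:
  fixes A B :: "complex mat"
  assumes "A \<in> carrier_mat a b" "B \<in> carrier_mat b c"
  shows "mat_adjoint (A * B) = mat_adjoint B * mat_adjoint A"
proof (rule eq_matI)
  fix i j assume "i < dim_row (mat_adjoint B * mat_adjoint A)"
    "j < dim_col (mat_adjoint B * mat_adjoint A)"
  with assms have ij: "i < c" "j < a" by auto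
  have "mat_adjoint (A * B) $$ (i, j) = cnj ((A * B) $$ (j, i))"
    using assms ij by (subst index_mat_adjoint) auto
  also have "\<dots> = (\<Sum>h<b. mat_adjoint B $$ (i, h) * mat_adjoint A $$ (h, j))"
    using assms ij by (subst index_mult_mat_sum[OF assms]) (auto simp: mult.commute intro!: sum.cong)
  also have "\<dots> = (mat_adjoint B * mat_adjoint A) $$ (i, j)"
    using assms ij by (subst index_mult_mat_sum[of _ c b _ a]) auto
  finally show "mat_adjoint (A * B) $$ (i, j) = (mat_adjoint B * mat_adjoint A) $$ (i, j)" .
qed (use assms in auto)

lemma mat_adjoint_adjoint [simp]: "mat_adjoint (mat_adjoint A) = (A :: complex mat)"
  by (rule eq_matI) auto

lemma mat_adjoint_one [simp]: "mat_adjoint (1\<^sub>m d) = (1\<^sub>m d :: complex mat)"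
  by (rule eq_matI) auto

lemma unitary_mat_carrier [simp]: "unitary_mat d U \<Longrightarrow> U \<in> carrier_mat d d"
  by (simp add: unitary_mat_def)

lemma unitary_mat_one [simp]: "unitary_mat d (1\<^sub>m d)"
  by (simp add: unitary_mat_def)

lemma unitary_mat_adjoint [simp]: "unitary_mat d U \<Longrightarrow> unitary_mat d (mat_adjoint U)"
  by (simp add: unitary_mat_def)

lemma unitary_mat_mult [simp]:
  assumes U: "unitary_mat d U" and V: "unitary_mat d V"
  shows "unitary_mat d (U * V)"
proof -
  have c: "U \<in> carrier_mat d d" "V \<in> carrier_mat d d" "mat_adjoint U \<in> carrier_mat d d"
     "mat_adjoint V \<in> carrier_mat d d"
    using U V by simp_all
  have "mat_adjoint U * (U * V) = V" "V * (mat_adjoint V * mat_adjoint U) = mat_adjoint U"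
    using U V c by (simp_all add: unitary_mat_def assoc_mult_mat[symmetric, of _ d d _ d _ d]
        del: assoc_mult_mat)
  moreover have "mat_adjoint (U * V) * (U * V) = mat_adjoint V * (mat_adjoint U * (U * V))"
    "(U * V) * mat_adjoint (U * V) = U * (V * (mat_adjoint V * mat_adjoint U))"
    using c by (simp_all add: mat_adjoint_mult[OF c(1,2)] assoc_mult_mat[of _ d d _ d _ d]
        mult_carrier_mat[of _ d d _ d])
  ultimately show ?thesis
    using U V c by (simp add: unitary_mat_def)
qed

lemma unitary_mat_selfadjoint:
  assumes "U \<in> carrier_mat d d" "mat_adjoint U = U" "U * U = 1\<^sub>m d"
  shows "unitary_mat d U"
  using assms by (simp add: unitary_mat_def)

text \<open>Diagonal entry \<open>(j, j)\<close> of \<open>mat_adjoint U * U = 1\<^sub>m d\<close>.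
  For column 0 it says that the outcome probabilities of a measurement add up to 1.\<close>

lemma unitary_mat_col_norm:
  assumes U: "unitary_mat d U" and j: "j < d"
  shows "(\<Sum>i<d. (cmod (U $$ (i, j)))\<^sup>2) = 1"
proof -
  have c: "U \<in> carrier_mat d d" "mat_adjoint U \<in> carrier_mat d d" using U by simp_all
  have "1 = (mat_adjoint U * U) $$ (j, j)"
    using U j by (simp add: unitary_mat_def)
  also have "\<dots> = (\<Sum>i<d. cnj (U $$ (i, j)) * U $$ (i, j))"
    using c j by (subst index_mult_mat_sum[OF c(2,1) j j]) (auto intro!: sum.cong)
  also have "\<dots> = complex_of_real (\<Sum>i<d. (cmod (U $$ (i, j)))\<^sup>2)"
    by (simp add: complex_norm_square mult.commute del: of_real_power)
  finally show ?thesis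
    by (metis of_real_eq_1_iff)
qed

section \<open>Permutation matrices and sign matrices\<close>

definition perm_mat :: "nat \<Rightarrow> (nat \<Rightarrow> nat) \<Rightarrow> complex mat" where
  "perm_mat d \<sigma> = Matrix.mat d d (\<lambda>(r, c). if r = \<sigma> c then 1 else 0)"

lemma perm_mat_carrier [simp]: "perm_mat d \<sigma> \<in> carrier_mat d d"
  by (simp add: perm_mat_def)

lemma dim_perm_mat [simp]: "dim_row (perm_mat d \<sigma>) = d" "dim_col (perm_mat d \<sigma>) = d"
  by (simp_all add: perm_mat_def)

lemma index_perm_mat [simp]:
  "r < d \<Longrightarrow> c < d \<Longrightarrow> perm_mat d \<sigma> $$ (r, c) = (if r = \<sigma> c then 1 else 0)"
  by (simp add: perm_mat_def)

lemma perm_mat_cong: "(\<And>c. c < d \<Longrightarrow> \<sigma> c = \<tau> c) \<Longrightarrow> perm_mat d \<sigma> = perm_mat d \<tau>"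
  by (rule eq_matI) auto

lemma perm_mat_id: "perm_mat d (\<lambda>c. c) = 1\<^sub>m d"
  by (rule eq_matI) auto

lemma perm_mat_mult:
  assumes "\<And>c. c < d \<Longrightarrow> \<tau> c < d"
  shows "perm_mat d \<sigma> * perm_mat d \<tau> = perm_mat d (\<sigma> \<circ> \<tau>)"
proof (rule eq_matI)
  fix i j assume "i < dim_row (perm_mat d (\<sigma> \<circ> \<tau>))" "j < dim_col (perm_mat d (\<sigma> \<circ> \<tau>))"
  hence ij: "i < d" "j < d" by simp_all
  have "(perm_mat d \<sigma> * perm_mat d \<tau>) $$ (i, j) =
    (\<Sum>h<d. (if i = \<sigma> h then 1 else 0) * (if h = \<tau> j then 1 else 0))"
    using ij by (subst index_mult_mat_sum[of _ d d _ d]) (auto intro!: sum.cong)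
  also have "\<dots> = (\<Sum>h<d. if h = \<tau> j then (if i = \<sigma> h then 1 else 0) else 0)"
    by (intro sum.cong) auto
  also have "\<dots> = perm_mat d (\<sigma> \<circ> \<tau>) $$ (i, j)"
    using ij assms[of j] by (simp add: sum.delta)
  finally show "(perm_mat d \<sigma> * perm_mat d \<tau>) $$ (i, j) = perm_mat d (\<sigma> \<circ> \<tau>) $$ (i, j)" .
qed simp_all

text \<open>The inverse \<tau> is given explicitly, since \<sigma> is a bijection of
  \<open>{..<d}\<close> only; outside this range both maps are arbitrary.\<close>

lemma mat_adjoint_perm_mat:
  assumes "\<And>c. c < d \<Longrightarrow> \<sigma> c < d \<and> \<tau> (\<sigma> c) = c" "\<And>c. c < d \<Longrightarrow> \<tau> c < d \<and> \<sigma> (\<tau> c) = c"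
  shows "mat_adjoint (perm_mat d \<sigma>) = perm_mat d \<tau>"
proof (rule eq_matI)
  fix i j assume "i < dim_row (perm_mat d \<tau>)" "j < dim_col (perm_mat d \<tau>)"
  hence ij: "i < d" "j < d" by simp_all
  have "j = \<sigma> i \<longleftrightarrow> i = \<tau> j" using assms(1)[OF ij(1)] assms(2)[OF ij(2)] by auto
  thus "mat_adjoint (perm_mat d \<sigma>) $$ (i, j) = perm_mat d \<tau> $$ (i, j)"
    using ij by simp
qed simp_all

lemma unitary_perm_mat:
  assumes \<sigma>: "\<And>c. c < d \<Longrightarrow> \<sigma> c < d \<and> \<tau> (\<sigma> c) = c"
    and \<tau>: "\<And>c. c < d \<Longrightarrow> \<tau> c < d \<and> \<sigma> (\<tau> c) = c"
  shows "unitary_mat d (perm_mat d \<sigma>)"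
proof -
  have "perm_mat d \<tau> * perm_mat d \<sigma> = 1\<^sub>m d" "perm_mat d \<sigma> * perm_mat d \<tau> = 1\<^sub>m d"
    using \<sigma> \<tau> by (auto simp: perm_mat_mult perm_mat_id[symmetric] intro!: perm_mat_cong)
  thus ?thesis
    by (simp add: unitary_mat_def mat_adjoint_perm_mat[OF \<sigma> \<tau>])
qed

text \<open>The reflection \<open>2 P - 1\<close>, where \<open>P\<close> is the orthogonal
  projection onto the span of the basis states in \<open>S\<close>. For an accepting set
  \<open>S\<close> its expectation is the bias; for \<open>S = {0}\<close> it is the reflection
  about the initial state.\<close>

definition sign_mat :: "nat \<Rightarrow> nat set \<Rightarrow> complex mat" where
  "sign_mat d S = Matrix.mat d d (\<lambda>(r, c). if r = c then (if r \<in> S then 1 else -1) else 0)"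

lemma sign_mat_carrier [simp]: "sign_mat d S \<in> carrier_mat d d"
  by (simp add: sign_mat_def)

lemma index_sign_mat_mult:
  assumes "B \<in> carrier_mat d e" "i < d" "j < e"
  shows "(sign_mat d S * B) $$ (i, j) = (if i \<in> S then B $$ (i, j) else - B $$ (i, j))"
proof -
  have "(sign_mat d S * B) $$ (i, j) = (\<Sum>h<d. sign_mat d S $$ (i, h) * B $$ (h, j))"
    by (rule index_mult_mat_sum[OF sign_mat_carrier assms])
  also have "\<dots> = (\<Sum>h<d. if h = i then (if i \<in> S then B $$ (i, j) else - B $$ (i, j)) else 0)"
    using assms by (intro sum.cong) (auto simp: sign_mat_def)
  finally have "(sign_mat d S * B) $$ (i, j) =
     (\<Sum>h<d. if h = i then (if i \<in> S then B $$ (i, j) else - B $$ (i, j)) else 0)" .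
  thus ?thesis using assms by simp
qed

lemma sign_mat_square: "sign_mat d S * sign_mat d S = 1\<^sub>m d"
proof (rule eq_matI)
  fix i j assume "i < dim_row (1\<^sub>m d :: complex mat)" "j < dim_col (1\<^sub>m d :: complex mat)"
  hence "i < d" "j < d" by simp_all
  thus "(sign_mat d S * sign_mat d S) $$ (i, j) = 1\<^sub>m d $$ (i, j)"
    by (subst index_sign_mat_mult[of _ d d]) (auto simp: sign_mat_def)
qed (simp_all add: sign_mat_def)

lemma mat_adjoint_sign_mat: "mat_adjoint (sign_mat d S) = sign_mat d S"
  by (rule eq_matI) (auto simp: sign_mat_def)

lemma unitary_sign_mat [simp]: "unitary_mat d (sign_mat d S)"
  by (intro unitary_mat_selfadjoint sign_mat_square mat_adjoint_sign_mat) simp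

text \<open>Block-diagonal control: the operator \<open>F j\<close> is applied to the first tensor factor when the
  second factor is in the basis state \<open>j\<close>; the pair \<open>(a, j)\<close> is encoded as \<open>a * l + j\<close>.\<close>

definition mux :: "nat \<Rightarrow> nat \<Rightarrow> (nat \<Rightarrow> complex mat) \<Rightarrow> complex mat" where
  "mux d l F = Matrix.mat (d * l) (d * l)
     (\<lambda>(r, c). if r mod l = c mod l then F (c mod l) $$ (r div l, c div l) else 0)"

lemma mux_carrier [simp]: "mux d l F \<in> carrier_mat (d * l) (d * l)"
  by (simp add: mux_def)

lemma div_mod_less:
  fixes r d l :: nat
  assumes "r < d * l"
  shows "r div l < d" "r mod l < l" "l > 0"
proof -
  show l: "l > 0" using assms by (cases l) auto
  show "r div l < d" using assms by (simp add: less_mult_imp_div_less)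
  show "r mod l < l" using l by simp
qed

lemma pair_index_less:
  fixes a j d l :: nat
  assumes "a < d" "j < l"
  shows "a * l + j < d * l"
proof -
  have "a * l + j < Suc a * l" using assms by simp
  also have "\<dots> \<le> d * l" using assms by (intro mult_le_mono1) simp
  finally show ?thesis .
qed

lemma sum_pair_index:
  "(\<Sum>h<d * (l::nat). f h) = (\<Sum>a<d. \<Sum>j<l. f (a * l + j))"
  by (simp add: sum_mult_product add.commute)

lemma index_mux [simp]:
  "r < d * l \<Longrightarrow> c < d * l \<Longrightarrow> mux d l F $$ (r, c) =
    (if r mod l = c mod l then F (c mod l) $$ (r div l, c div l) else 0)"
  by (simp add: mux_def)

lemma index_mux_mult:
  assumes F: "\<And>j. j < l \<Longrightarrow> F j \<in> carrier_mat d d" and B: "B \<in> carrier_mat (d * l) e"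
    and r: "r < d * l" and c: "c < e"
  shows "(mux d l F * B) $$ (r, c) =
     (\<Sum>a<d. F (r mod l) $$ (r div l, a) * B $$ (a * l + r mod l, c))"
proof -
  note dm = div_mod_less[OF r]
  have "(mux d l F * B) $$ (r, c) = (\<Sum>h<d * l. mux d l F $$ (r, h) * B $$ (h, c))"
    by (rule index_mult_mat_sum[OF mux_carrier B r c])
  also have "\<dots> = (\<Sum>a<d. \<Sum>j<l. mux d l F $$ (r, a * l + j) * B $$ (a * l + j, c))"
    by (rule sum_pair_index)
  also have "\<dots> = (\<Sum>a<d. \<Sum>j<l. if j = r mod l then
      F (r mod l) $$ (r div l, a) * B $$ (a * l + r mod l, c) else 0)"
    using r by (intro sum.cong refl) (auto simp: pair_index_less)
  also have "\<dots> = (\<Sum>a<d. F (r mod l) $$ (r div l, a) * B $$ (a * l + r mod l, c))"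
    using dm by simp
  finally show ?thesis .
qed

lemma mux_mult:
  assumes F: "\<And>j. j < l \<Longrightarrow> F j \<in> carrier_mat d d" and G: "\<And>j. j < l \<Longrightarrow> G j \<in> carrier_mat d d"
  shows "mux d l F * mux d l G = mux d l (\<lambda>j. F j * G j)"
proof (rule eq_matI)
  fix r c assume "r < dim_row (mux d l (\<lambda>j. F j * G j))" "c < dim_col (mux d l (\<lambda>j. F j * G j))"
  hence rc: "r < d * l" "c < d * l" by (simp_all add: mux_def)
  note dm = div_mod_less[OF rc(1)] div_mod_less[OF rc(2)]
  have "(mux d l F * mux d l G) $$ (r, c) =
     (\<Sum>a<d. F (r mod l) $$ (r div l, a) * mux d l G $$ (a * l + r mod l, c))"
    by (rule index_mux_mult[OF F mux_carrier rc])
  also have "\<dots> = (\<Sum>a<d. if r mod l = c mod l then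
      F (c mod l) $$ (r div l, a) * G (c mod l) $$ (a, c div l) else 0)"
    using rc dm by (intro sum.cong refl) (auto simp: pair_index_less)
  also have "\<dots> = mux d l (\<lambda>j. F j * G j) $$ (r, c)"
    using rc dm by (cases "r mod l = c mod l") (simp_all add: index_mult_mat_sum[OF F G] del: index_mult_mat)
  finally show "(mux d l F * mux d l G) $$ (r, c) = mux d l (\<lambda>j. F j * G j) $$ (r, c)" .
qed (simp_all add: mux_def)

lemma mux_one: "mux d l (\<lambda>_. 1\<^sub>m d) = 1\<^sub>m (d * l)"
proof (rule eq_matI)
  fix r c assume "r < dim_row (1\<^sub>m (d * l) :: complex mat)" "c < dim_col (1\<^sub>m (d * l) :: complex mat)"
  hence rc: "r < d * l" "c < d * l" by simp_all
  have "r = c \<longleftrightarrow> r div l = c div l \<and> r mod l = c mod l"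
    by (metis div_mult_mod_eq)
  thus "mux d l (\<lambda>_. 1\<^sub>m d) $$ (r, c) = 1\<^sub>m (d * l) $$ (r, c)"
    using rc div_mod_less[OF rc(1)] div_mod_less[OF rc(2)] by auto
qed (simp_all add: mux_def)

lemma mux_cong: "(\<And>j. j < l \<Longrightarrow> F j = G j) \<Longrightarrow> mux d l F = mux d l G"
  by (rule eq_matI) (auto simp: mux_def dest!: div_mod_less(2))

lemma mat_adjoint_mux:
  assumes F: "\<And>j. j < l \<Longrightarrow> F j \<in> carrier_mat d d"
  shows "mat_adjoint (mux d l F) = mux d l (\<lambda>j. mat_adjoint (F j))"
proof (rule eq_matI)
  fix r c assume "r < dim_row (mux d l (\<lambda>j. mat_adjoint (F j)))"
    "c < dim_col (mux d l (\<lambda>j. mat_adjoint (F j)))"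
  hence rc: "r < d * l" "c < d * l" by (simp_all add: mux_def)
  note dm = div_mod_less[OF rc(1)] div_mod_less[OF rc(2)]
  have "F (c mod l) \<in> carrier_mat d d" using F dm by simp
  hence "dim_row (F (c mod l)) = d" "dim_col (F (c mod l)) = d" by auto
  thus "mat_adjoint (mux d l F) $$ (r, c) = mux d l (\<lambda>j. mat_adjoint (F j)) $$ (r, c)"
    using rc dm by (subst index_mat_adjoint) (auto simp: mux_def)
qed (simp_all add: mux_def)

lemma unitary_mux:
  assumes F: "\<And>j. j < l \<Longrightarrow> unitary_mat d (F j)"
  shows "unitary_mat (d * l) (mux d l F)"
proof -
  have "mat_adjoint (mux d l F) * mux d l F = mux d l (\<lambda>_. 1\<^sub>m d)"
    "mux d l F * mat_adjoint (mux d l F) = mux d l (\<lambda>_. 1\<^sub>m d)"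
    using F by (auto simp: mat_adjoint_mux mux_mult unitary_mat_def intro!: mux_cong)
  thus ?thesis by (simp add: unitary_mat_def mux_one)
qed

section \<open>The oracle and query circuits\<close>

lemma index_perm_mat_mult:
  assumes B: "B \<in> carrier_mat d e" and r: "r < d" and c: "c < e"
    and \<sigma>: "\<And>c. c < d \<Longrightarrow> \<sigma> c < d \<and> \<tau> (\<sigma> c) = c" and \<tau>: "\<And>c. c < d \<Longrightarrow> \<tau> c < d \<and> \<sigma> (\<tau> c) = c"
  shows "(perm_mat d \<sigma> * B) $$ (r, c) = B $$ (\<tau> r, c)"
proof -
  have "(perm_mat d \<sigma> * B) $$ (r, c) = (\<Sum>h<d. perm_mat d \<sigma> $$ (r, h) * B $$ (h, c))"
    by (rule index_mult_mat_sum[OF perm_mat_carrier B r c])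
  also have "\<dots> = (\<Sum>h<d. if h = \<tau> r then B $$ (\<tau> r, c) else 0)"
    using r \<sigma> \<tau> by (intro sum.cong refl) auto
  also have "\<dots> = B $$ (\<tau> r, c)" using \<tau>[OF r] by simp
  finally show ?thesis .
qed

lemma mux_perm_mat:
  assumes "\<And>c. c < d \<Longrightarrow> \<sigma> c < d"
  shows "mux d l (\<lambda>_. perm_mat d \<sigma>) = perm_mat (d * l) (\<lambda>c. \<sigma> (c div l) * l + c mod l)"
proof (rule eq_matI)
  fix r c assume "r < dim_row (perm_mat (d * l) (\<lambda>c. \<sigma> (c div l) * l + c mod l))"
    "c < dim_col (perm_mat (d * l) (\<lambda>c. \<sigma> (c div l) * l + c mod l))"
  hence rc: "r < d * l" "c < d * l" by simp_all
  note dm = div_mod_less[OF rc(1)] div_mod_less[OF rc(2)]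
  have "r = \<sigma> (c div l) * l + c mod l \<longleftrightarrow> r div l = \<sigma> (c div l) \<and> r mod l = c mod l"
    using dm by (metis div_mult_mod_eq div_mult_self3 div_less mod_mult_self3 mod_less add.right_neutral
        bot_nat_0.not_eq_extremum add.commute div_mult_self1)
  thus "mux d l (\<lambda>_. perm_mat d \<sigma>) $$ (r, c) = perm_mat (d * l) (\<lambda>c. \<sigma> (c div l) * l + c mod l) $$ (r, c)"
    using rc dm by auto
qed (simp_all add: mux_def)

text \<open>Exchange of the two factors of a square tensor product, in the encoding of
  \<open>mux\<close>. It serves to move the result of a computation into the controlling
  factor.\<close>

definition swap_index :: "nat \<Rightarrow> nat \<Rightarrow> nat" where
  "swap_index d c = (c mod d) * d + c div d"

lemma swap_index_pair: "a < d \<Longrightarrow> j < d \<Longrightarrow> swap_index d (a * d + j) = j * d + a"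
  by (simp add: swap_index_def)

lemma swap_index_involution: "c < d * d \<Longrightarrow> swap_index d c < d * d \<and> swap_index d (swap_index d c) = c"
  using div_mod_less[of c d d] by (simp add: swap_index_def pair_index_less)

text \<open>Common form of the oracle and of the negation: the answer register is changed by a map
  that depends on the index register. Composing such operators reduces to composing maps on
  \<open>{..<k}\<close>.\<close>

definition map_answer :: "nat \<Rightarrow> nat \<Rightarrow> (nat \<Rightarrow> nat \<Rightarrow> nat) \<Rightarrow> nat \<Rightarrow> nat" where
  "map_answer k m g c = basis_index k m (c div (k * m)) (g (c div (k * m)) (c div m mod k)) (c mod m)"

lemma basis_index_decode:
  assumes "b < k" "w < m"
  shows "basis_index k m i b w div (k * m) = i" "basis_index k m i b w div m mod k = b"
    "basis_index k m i b w mod m = w"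
proof -
  show 1: "basis_index k m i b w mod m = w" using assms by (simp add: basis_index_def)
  have 2: "basis_index k m i b w div m = i * k + b" using assms by (simp add: basis_index_def)
  show "basis_index k m i b w div m mod k = b" using assms 2 by simp
  have "basis_index k m i b w div (k * m) = basis_index k m i b w div m div k"
    by (metis div_mult2_eq mult.commute)
  thus "basis_index k m i b w div (k * m) = i" using assms 2 by simp
qed

lemma basis_index_less:
  assumes "i \<le> n" "b < k" "w < m"
  shows "basis_index k m i b w < qdim k n m"
  unfolding basis_index_def qdim_def using assms by (intro pair_index_less) auto

lemma basis_index_encode:
  assumes "0 < k" "0 < m"
  shows "basis_index k m (c div (k * m)) (c div m mod k) (c mod m) = c"
proof -
  have "c div (k * m) = c div m div k" by (metis div_mult2_eq mult.commute)
  thus ?thesis by (simp add: basis_index_def)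
qed

lemma map_answer_comp:
  assumes "0 < k" "0 < m" "\<And>i b. b < k \<Longrightarrow> h i b < k"
  shows "map_answer k m g (map_answer k m h c) = map_answer k m (\<lambda>i b. g i (h i b)) c"
  using assms by (simp add: map_answer_def basis_index_decode)

lemma map_answer_id:
  assumes "0 < k" "0 < m" "\<And>i b. b < k \<Longrightarrow> g i b = b"
  shows "map_answer k m g c = c"
  using assms by (simp add: map_answer_def basis_index_encode)

lemma map_answer_less:
  assumes "0 < k" "0 < m" "\<And>i b. b < k \<Longrightarrow> g i b < k" "c < qdim k n m"
  shows "map_answer k m g c < qdim k n m"
proof -
  have "c < Suc n * (k * m)" using assms by (simp only: qdim_def mult.assoc)
  hence "c div (k * m) < Suc n" by (rule div_mod_less)
  thus ?thesis unfolding map_answer_def using assms by (intro basis_index_less) auto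
qed

definition query_answer :: "nat \<Rightarrow> nat \<Rightarrow> nat list \<Rightarrow> nat \<Rightarrow> nat \<Rightarrow> nat" where
  "query_answer k n x i b = (if i < n then (b + x ! i) mod k else b)"

definition neg_answer :: "nat \<Rightarrow> nat \<Rightarrow> nat \<Rightarrow> nat" where
  "neg_answer k i b = (k - b) mod k"

lemma query_answer_less: "b < k \<Longrightarrow> query_answer k n x i b < k"
  by (simp add: query_answer_def)

lemma neg_answer_less: "b < k \<Longrightarrow> neg_answer k i b < k"
  by (simp add: neg_answer_def)

lemma neg_neg_answer: "b < k \<Longrightarrow> neg_answer k i (neg_answer k i b) = b"
  by (cases "b = 0") (simp_all add: neg_answer_def)

text \<open>Modulo \<open>k\<close> this is \<open>-(b + y) + y = -b\<close>. It makes the query,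
  conjugated by negation, the inverse of the query.\<close>

lemma query_neg_query_answer:
  assumes "b < k"
  shows "query_answer k n x i (neg_answer k i (query_answer k n x i b)) = neg_answer k i b"
proof (cases "i < n")
  case True
  define y where "y = x ! i"
  define q r where "q = (b + y) div k" and "r = (b + y) mod k"
  have r: "r < k" and e: "q * k + r = b + y" using assms by (simp_all add: q_def r_def)
  \<comment> \<open>The differences are exact on the naturals because \<open>r < k\<close> and
    \<open>b < k\<close>; the multiple \<open>q * k\<close> vanishes modulo
    \<open>k\<close>.\<close>
  have "k - r + y = (k - b) + q * k" using r e assms by linarith
  hence "((k - r) mod k + y) mod k = (k - b) mod k"
    by (metis mod_add_left_eq mod_mult_self1)
  thus ?thesis using True by (simp add: query_answer_def neg_answer_def y_def r_def)
qed (simp add: query_answer_def)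

lemma oracle_mat_perm: "oracle_mat k n m x = perm_mat (qdim k n m) (map_answer k m (query_answer k n x))"
  by (rule eq_matI) (simp_all add: oracle_mat_def map_answer_def query_answer_def Let_def)

definition neg_mat :: "nat \<Rightarrow> nat \<Rightarrow> nat \<Rightarrow> complex mat" where
  "neg_mat k n m = perm_mat (qdim k n m) (map_answer k m (neg_answer k))"

lemma oracle_mat_carrier [simp]: "oracle_mat k n m x \<in> carrier_mat (qdim k n m) (qdim k n m)"
  by (simp add: oracle_mat_perm)

locale query_model =
  fixes k n :: nat
  assumes k_pos: "0 < k"
begin

lemma unitary_neg_mat: "0 < m \<Longrightarrow> unitary_mat (qdim k n m) (neg_mat k n m)"
  unfolding neg_mat_def using k_pos
  by (intro unitary_perm_mat[where \<tau> = "map_answer k m (neg_answer k)"])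
     (auto intro!: map_answer_less simp: map_answer_comp neg_answer_less neg_neg_answer map_answer_id)

text \<open>Negating the answer register turns \<open>b + x\<^sub>i\<close> into \<open>b - x\<^sub>i\<close>, so that the inverse oracle
  costs a single query.\<close>

lemma mat_adjoint_oracle:
  assumes m: "0 < m"
  shows "mat_adjoint (oracle_mat k n m x) = neg_mat k n m * (oracle_mat k n m x * neg_mat k n m)"
proof -
  let ?d = "qdim k n m"
  let ?q = "query_answer k n x" and ?s = "neg_answer k"
  let ?t = "\<lambda>i b. ?s i (?q i (?s i b))"
  have "mat_adjoint (oracle_mat k n m x) = perm_mat ?d (map_answer k m ?t)"
    unfolding oracle_mat_perm using k_pos m
    by (intro mat_adjoint_perm_mat)
      (auto intro!: map_answer_less simp: map_answer_comp neg_answer_less neg_neg_answer map_answer_id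
        query_answer_less query_neg_query_answer)
  also have "\<dots> = neg_mat k n m * (oracle_mat k n m x * neg_mat k n m)"
    unfolding oracle_mat_perm neg_mat_def using k_pos m
    by (simp add: perm_mat_mult map_answer_less neg_answer_less query_answer_less)
      (rule perm_mat_cong, simp add: map_answer_comp neg_answer_less query_answer_less)
  finally show ?thesis .
qed

text \<open>Adding any number modulo \<open>k\<close> is a bijection, so this holds for every list
  \<open>x\<close>, and the constructions below can be stated for all \<open>x\<close> at
  once.\<close>

lemma unitary_oracle [simp]:
  assumes m: "0 < m"
  shows "unitary_mat (qdim k n m) (oracle_mat k n m x)"
  unfolding oracle_mat_perm using k_pos m
    by (intro unitary_perm_mat[where \<tau> = "map_answer k m (\<lambda>i b. neg_answer k i (query_answer k n x i (neg_answer k i b)))"])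
      (auto intro!: map_answer_less simp: map_answer_comp neg_answer_less neg_neg_answer map_answer_id
        query_answer_less query_neg_query_answer)

lemma qdim_mult: "qdim k n (m * l) = qdim k n m * l"
  by (simp add: qdim_def mult.assoc)

lemma qdim_pos: "0 < m \<Longrightarrow> 0 < qdim k n m"
  using k_pos by (simp add: qdim_def)

lemma mux_oracle:
  assumes m: "0 < m" "0 < l"
  shows "mux (qdim k n m) l (\<lambda>_. oracle_mat k n m x) = oracle_mat k n (m * l) x"
proof -
  let ?q = "query_answer k n x"
  have "map_answer k m ?q (c div l) * l + c mod l = map_answer k (m * l) ?q c" for c
  proof -
    have 1: "c div l div (k * m) = c div (k * (m * l))"
      by (metis div_mult2_eq mult.commute mult.assoc)
    have 2: "c div l div m = c div (m * l)"
      by (metis div_mult2_eq mult.commute)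
    have 3: "c mod (m * l) = (c div l mod m) * l + c mod l"
      by (metis mod_mult2_eq mult.commute)
    show ?thesis
      unfolding map_answer_def basis_index_def 1 2 3 by (simp add: algebra_simps)
  qed
  thus ?thesis
    unfolding oracle_mat_perm qdim_mult using k_pos m
    by (subst mux_perm_mat) (auto intro!: map_answer_less simp: query_answer_less)
qed

text \<open>An algorithm as an operator-valued function of the input, so that whole algorithms can
  be multiplied, inverted and controlled. The unitaries are chosen before \<open>x\<close>, which
  enters only through the oracle; the number of queries is exactly \<open>T\<close>.\<close>

fun circuit :: "nat \<Rightarrow> nat \<Rightarrow> (nat list \<Rightarrow> complex mat) \<Rightarrow> bool" where
  "circuit m 0 V \<longleftrightarrow> (\<exists>U. unitary_mat (qdim k n m) U \<and> V = (\<lambda>x. U))"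
| "circuit m (Suc T) V \<longleftrightarrow> (\<exists>U W. unitary_mat (qdim k n m) U \<and> circuit m T W \<and>
     V = (\<lambda>x. U * (oracle_mat k n m x * W x)))"

lemma circuit_0I: "unitary_mat (qdim k n m) U \<Longrightarrow> circuit m 0 (\<lambda>x. U)"
  by auto

lemma circuit_SucI:
  "unitary_mat (qdim k n m) U \<Longrightarrow> circuit m T W \<Longrightarrow>
    circuit m (Suc T) (\<lambda>x. U * (oracle_mat k n m x * W x))"
  by auto

lemma circuit_unitary:
  assumes "0 < m" "circuit m T V"
  shows "unitary_mat (qdim k n m) (V x)"
  using assms(2) by (induction T arbitrary: V) (auto simp: assms(1))

lemma circuit_carrier:
  assumes "0 < m" "circuit m T V"
  shows "V x \<in> carrier_mat (qdim k n m) (qdim k n m)"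
  using circuit_unitary[OF assms] by simp

lemma circuit_unitary_mult:
  assumes m: "0 < m" and U: "unitary_mat (qdim k n m) U" and V: "circuit m T V"
  shows "circuit m T (\<lambda>x. U * V x)"
proof (cases T)
  case 0
  with V obtain U' where "unitary_mat (qdim k n m) U'" "V = (\<lambda>x. U')" by auto
  then show ?thesis using 0 U circuit_0I[of m "U * U'"] by simp
next
  case (Suc T')
  let ?d = "qdim k n m"
  from V Suc obtain U' W where *: "unitary_mat ?d U'" "circuit m T' W"
    "V = (\<lambda>x. U' * (oracle_mat k n m x * W x))" by auto
  have "U * V x = (U * U') * (oracle_mat k n m x * W x)" for x
    using U * circuit_carrier[OF m *(2), of x]
    by (simp add: assoc_mult_mat[of _ ?d ?d _ ?d _ ?d] mult_carrier_mat[of _ ?d ?d _ ?d])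
  thus ?thesis using Suc * U
    by (auto intro!: exI[of _ "U * U'"] exI[of _ W])
qed

lemma circuit_mult:
  assumes m: "0 < m" and V: "circuit m T V" and V': "circuit m T' V'"
  shows "circuit m (T + T') (\<lambda>x. V x * V' x)"
  using V
proof (induction T arbitrary: V)
  case 0
  then show ?case using circuit_unitary_mult[OF m _ V'] by auto
next
  case (Suc T)
  let ?d = "qdim k n m"
  from Suc.prems obtain U W where *: "unitary_mat ?d U" "circuit m T W"
    "V = (\<lambda>x. U * (oracle_mat k n m x * W x))" by auto
  have "V x * V' x = U * (oracle_mat k n m x * (W x * V' x))" for x
    using * circuit_carrier[OF m *(2), of x] circuit_carrier[OF m V', of x]
    by (simp add: assoc_mult_mat[of _ ?d ?d _ ?d _ ?d] mult_carrier_mat[of _ ?d ?d _ ?d])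
  thus ?case using * Suc.IH[OF *(2)]
    by (auto intro!: exI[of _ U] exI[of _ "\<lambda>x. W x * V' x"])
qed

text \<open>The circuit is run backwards. Each inverse query is one query between two negations, by
  \<open>mat_adjoint_oracle\<close>, so the number of queries does not change.\<close>

lemma circuit_adjoint:
  assumes m: "0 < m" and V: "circuit m T V"
  shows "circuit m T (\<lambda>x. mat_adjoint (V x))"
  using V
proof (induction T arbitrary: V)
  case 0
  then obtain U where "unitary_mat (qdim k n m) U" "V = (\<lambda>x. U)" by auto
  then show ?case using circuit_0I[of m "mat_adjoint U"] by simp
next
  case (Suc T)
  let ?d = "qdim k n m"
  from Suc.prems obtain U W where *: "unitary_mat ?d U" "circuit m T W"
    "V = (\<lambda>x. U * (oracle_mat k n m x * W x))" by auto
  have N: "unitary_mat ?d (neg_mat k n m)" using unitary_neg_mat m .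
  \<comment> \<open>The outermost round, inverted, as a circuit with a single query.\<close>
  have "circuit m (Suc 0) (\<lambda>x. neg_mat k n m * (oracle_mat k n m x * (neg_mat k n m * mat_adjoint U)))"
    using N * by (intro circuit_SucI circuit_0I) simp_all
  from circuit_mult[OF m Suc.IH[OF *(2)] this]
  have "circuit m (Suc T) (\<lambda>x. mat_adjoint (W x) *
     (neg_mat k n m * (oracle_mat k n m x * (neg_mat k n m * mat_adjoint U))))" by simp
  moreover have "mat_adjoint (V x) = mat_adjoint (W x) *
     (neg_mat k n m * (oracle_mat k n m x * (neg_mat k n m * mat_adjoint U)))" for x
  proof -
    have c: "U \<in> carrier_mat ?d ?d" "W x \<in> carrier_mat ?d ?d" "neg_mat k n m \<in> carrier_mat ?d ?d"
      using * circuit_carrier[OF m *(2), of x] N by simp_all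
    hence c': "mat_adjoint U \<in> carrier_mat ?d ?d" "mat_adjoint (W x) \<in> carrier_mat ?d ?d" by simp_all
    have "mat_adjoint (V x) = (mat_adjoint (W x) * mat_adjoint (oracle_mat k n m x)) * mat_adjoint U"
      unfolding * using c
      by (simp add: mat_adjoint_mult[of _ ?d ?d _ ?d] mult_carrier_mat[of _ ?d ?d _ ?d])
    thus ?thesis using c c'
      by (simp add: mat_adjoint_oracle[OF m] assoc_mult_mat[of _ ?d ?d _ ?d _ ?d]
          mult_carrier_mat[of _ ?d ?d _ ?d])
  qed
  ultimately show ?case by presburger
qed

text \<open>All branches make their queries at the same times, so only the unitaries in between are
  controlled and the oracle calls are shared: the cost is \<open>T\<close> and not
  \<open>l * T\<close>.\<close>

lemma circuit_mux:
  assumes m: "0 < m" "0 < l" and V: "\<And>j. circuit m T (V j)"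
  shows "circuit (m * l) T (\<lambda>x. mux (qdim k n m) l (\<lambda>j. V j x))"
  using V
proof (induction T arbitrary: V)
  case 0
  hence "\<forall>j. \<exists>U. unitary_mat (qdim k n m) U \<and> V j = (\<lambda>x. U)" by simp
  then obtain U where "\<And>j. unitary_mat (qdim k n m) (U j)" "\<And>j. V j = (\<lambda>x. U j)" by metis
  then show ?case using circuit_0I[of "m * l" "mux (qdim k n m) l U"]
    by (simp add: qdim_mult unitary_mux del: circuit.simps)
next
  case (Suc T)
  let ?d = "qdim k n m"
  have "\<forall>j. \<exists>U W. unitary_mat ?d U \<and> circuit m T W \<and> V j = (\<lambda>x. U * (oracle_mat k n m x * W x))"
    using Suc.prems by simp
  then obtain U W where *: "\<And>j. unitary_mat ?d (U j)" "\<And>j. circuit m T (W j)"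
    "\<And>j. V j = (\<lambda>x. U j * (oracle_mat k n m x * W j x))" by metis
  have c: "\<And>j. U j \<in> carrier_mat ?d ?d" "\<And>j x. W j x \<in> carrier_mat ?d ?d"
    using * circuit_carrier[OF m(1) *(2)] by simp_all
  have "mux ?d l (\<lambda>j. V j x) =
     mux ?d l U * (oracle_mat k n (m * l) x * mux ?d l (\<lambda>j. W j x))" for x
    unfolding *(3) mux_oracle[OF m, symmetric]
    by (subst mux_mult mux_mult, auto simp: c mux_mult mult_carrier_mat[of _ ?d ?d _ ?d])
  thus ?case using Suc.IH[OF *(2)] *
    by (auto simp: qdim_mult intro!: exI[of _ "mux ?d l U"] exI[of _ "\<lambda>x. mux ?d l (\<lambda>j. W j x)"] unitary_mux)
qed

text \<open>The circuit \<open>V\<close> is the part already executed; \<open>T\<close> and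
  \<open>V\<close> vary in the induction because \<open>foldl\<close> consumes the rounds from the
  left.\<close>

lemma circuit_of_rounds:
  assumes m: "0 < m" and V: "circuit m T V" and Us: "\<forall>U \<in> set Us. unitary_mat (qdim k n m) U"
  shows "\<exists>W. circuit m (T + length Us) W \<and>
    (\<forall>x. foldl (\<lambda>v U. U *\<^sub>v (oracle_mat k n m x *\<^sub>v v)) (V x *\<^sub>v unit_vec (qdim k n m) 0) Us =
       W x *\<^sub>v unit_vec (qdim k n m) 0)"
  using V Us
proof (induction Us arbitrary: T V)
  case Nil
  then show ?case by auto
next
  case (Cons U Us)
  let ?d = "qdim k n m"
  have U: "unitary_mat ?d U" using Cons.prems by simp
  have "circuit m (Suc T) (\<lambda>x. U * (oracle_mat k n m x * V x))"
    using U Cons.prems by auto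
  from Cons.IH[OF this] Cons.prems obtain W where W: "circuit m (Suc T + length Us) W"
    "\<And>x. foldl (\<lambda>v U. U *\<^sub>v (oracle_mat k n m x *\<^sub>v v)) (U * (oracle_mat k n m x * V x) *\<^sub>v unit_vec ?d 0) Us =
       W x *\<^sub>v unit_vec ?d 0" by auto
  moreover have "U * (oracle_mat k n m x * V x) *\<^sub>v unit_vec ?d 0 =
      U *\<^sub>v (oracle_mat k n m x *\<^sub>v (V x *\<^sub>v unit_vec ?d 0))" for x
    using U circuit_carrier[OF m Cons.prems(1), of x]
    by (simp add: assoc_mult_mat_vec[of _ ?d ?d _ ?d] mult_carrier_mat[of _ ?d ?d _ ?d])
  ultimately show ?case by (intro exI[of _ W]) (simp del: circuit.simps)
qed

lemma rounds_of_circuit: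
  assumes m: "0 < m" and V: "circuit m T V"
  shows "\<exists>U Us. length Us = T \<and> (\<forall>U \<in> insert U (set Us). unitary_mat (qdim k n m) U) \<and>
    (\<forall>x. foldl (\<lambda>v U. U *\<^sub>v (oracle_mat k n m x *\<^sub>v v)) (U *\<^sub>v unit_vec (qdim k n m) 0) Us =
       V x *\<^sub>v unit_vec (qdim k n m) 0)"
  using V
proof (induction T arbitrary: V)
  case 0
  then show ?case by (auto intro!: exI[of _ "[]"])
next
  case (Suc T)
  let ?d = "qdim k n m"
  from Suc.prems obtain U W where *: "unitary_mat ?d U" "circuit m T W"
    "V = (\<lambda>x. U * (oracle_mat k n m x * W x))" by auto
  from Suc.IH[OF *(2)] obtain U0 Us where Us: "length Us = T"
    "\<forall>U \<in> insert U0 (set Us). unitary_mat ?d U"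
    "\<And>x. foldl (\<lambda>v U. U *\<^sub>v (oracle_mat k n m x *\<^sub>v v)) (U0 *\<^sub>v unit_vec ?d 0) Us =
       W x *\<^sub>v unit_vec ?d 0" by blast
  have "V x *\<^sub>v unit_vec ?d 0 = U *\<^sub>v (oracle_mat k n m x *\<^sub>v (W x *\<^sub>v unit_vec ?d 0))" for x
    using * circuit_carrier[OF m *(2), of x]
    by (simp add: assoc_mult_mat_vec[of _ ?d ?d _ ?d] mult_carrier_mat[of _ ?d ?d _ ?d])
  thus ?case using Us * by (intro exI[of _ U0] exI[of _ "Us @ [U]"]) auto
qed

end

section \<open>Acceptance probabilities and reflections\<close>

lemma bind_bernoulli_pmf:
  assumes "0 \<le> p" "p \<le> 1" "\<And>b. 0 \<le> q b" "\<And>b. q b \<le> 1"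
  shows "bind_pmf (bernoulli_pmf p) (\<lambda>b. bernoulli_pmf (q b)) =
    bernoulli_pmf (p * q True + (1 - p) * q False)"
proof (rule pmf_eqI)
  fix b
  have "p * q True + (1 - p) * q False \<le> p * 1 + (1 - p) * 1"
    using assms by (intro add_mono mult_left_mono) auto
  moreover have "0 \<le> p * q True + (1 - p) * q False"
    using assms by (intro add_nonneg_nonneg mult_nonneg_nonneg) auto
  ultimately show "pmf (bind_pmf (bernoulli_pmf p) (\<lambda>b. bernoulli_pmf (q b))) b =
      pmf (bernoulli_pmf (p * q True + (1 - p) * q False)) b"
    using assms by (cases b) (simp_all add: pmf_bind algebra_simps)
qed

lemma bernoulli_pmf_0: "bernoulli_pmf 0 = return_pmf False"
  by (rule pmf_eqI) (case_tac i, simp_all)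

lemma bernoulli_pmf_1: "bernoulli_pmf 1 = return_pmf True"
  by (rule pmf_eqI) (case_tac i, simp_all)

text \<open>Probability that a measurement gives an outcome in \<open>S\<close> after
  \<open>W\<close> has been applied to the first basis state, the result being column 0 of
  \<open>W\<close>.\<close>

definition col_prob :: "nat \<Rightarrow> nat set \<Rightarrow> complex mat \<Rightarrow> real" where
  "col_prob d S W = (\<Sum>j\<in>S \<inter> {..<d}. (cmod (W $$ (j, 0)))\<^sup>2)"

lemma col_prob_alt: "col_prob d S W = (\<Sum>j<d. if j \<in> S then (cmod (W $$ (j, 0)))\<^sup>2 else 0)"
  unfolding col_prob_def by (subst Int_commute) (simp add: sum.inter_restrict)

lemma col_prob_bounds:
  assumes "unitary_mat d W" "0 < d"
  shows "0 \<le> col_prob d S W" "col_prob d S W \<le> 1"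
proof -
  show "0 \<le> col_prob d S W" by (simp add: col_prob_def sum_nonneg)
  have "col_prob d S W \<le> (\<Sum>j<d. (cmod (W $$ (j, 0)))\<^sup>2)"
    unfolding col_prob_alt by (intro sum_mono) auto
  thus "col_prob d S W \<le> 1" using unitary_mat_col_norm[OF assms] by simp
qed

text \<open>The expectation of the reflection \<open>sign_mat d S\<close> in the final state is the
  acceptance minus the rejection probability. In this form the bias is accessible to
  amplification.\<close>

lemma col_prob_expectation:
  assumes U: "unitary_mat d U" and d: "0 < d"
  shows "(mat_adjoint U * (sign_mat d S * U)) $$ (0, 0) = of_real (2 * col_prob d S U - 1)"
proof -
  have c: "U \<in> carrier_mat d d" "mat_adjoint U \<in> carrier_mat d d" using U by simp_all
  have "(mat_adjoint U * (sign_mat d S * U)) $$ (0, 0) =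
     (\<Sum>h<d. mat_adjoint U $$ (0, h) * (sign_mat d S * U) $$ (h, 0))"
    using c d by (intro index_mult_mat_sum[of _ d d _ d]) (auto intro: mult_carrier_mat[of _ d d _ d])
  also have "\<dots> = (\<Sum>h<d. of_real ((if h \<in> S then 1 else -1) * (cmod (U $$ (h, 0)))\<^sup>2))"
  proof (intro sum.cong refl)
    fix h assume "h \<in> {..<d}"
    hence h: "h < d" by simp
    have "U $$ (h, 0) * cnj (U $$ (h, 0)) = of_real ((cmod (U $$ (h, 0)))\<^sup>2)"
      by (rule complex_norm_square[symmetric])
    thus "mat_adjoint U $$ (0, h) * (sign_mat d S * U) $$ (h, 0) =
       of_real ((if h \<in> S then 1 else -1) * (cmod (U $$ (h, 0)))\<^sup>2)"
      using c d h by (simp add: index_sign_mat_mult[OF c(1) h d] mult.commute del: index_mult_mat of_real_power)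
  qed
  also have "\<dots> = of_real (\<Sum>h<d. 2 * (if h \<in> S then (cmod (U $$ (h, 0)))\<^sup>2 else 0) - (cmod (U $$ (h, 0)))\<^sup>2)"
    unfolding of_real_sum by (intro sum.cong) auto
  also have "\<dots> = of_real (2 * col_prob d S U - 1)"
    using unitary_mat_col_norm[OF U d] by (simp only: sum_subtractf col_prob_alt sum_distrib_left)
  finally show ?thesis .
qed

text \<open>A real symmetric 2 by 2 reflection on the first two basis states, with first column
  \<open>(sqrt p, sqrt (1 - p))\<close>, extended by the identity. It acts as a coin that shows 0
  with probability \<open>p\<close> and needs no query.\<close>

definition reflect_entry :: "real \<Rightarrow> nat \<Rightarrow> nat \<Rightarrow> complex" where
  "reflect_entry p i j = (if i < 2 \<and> j < 2 then
      (if i = 0 \<and> j = 0 then of_real (sqrt p) else if i = 1 \<and> j = 1 then - of_real (sqrt p)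
       else of_real (sqrt (1 - p))) else if i = j then 1 else 0)"

definition reflect_mat :: "nat \<Rightarrow> real \<Rightarrow> complex mat" where
  "reflect_mat d p = Matrix.mat d d (\<lambda>(i, j). reflect_entry p i j)"

lemma unitary_reflect_mat:
  assumes d: "2 \<le> d" and p: "0 \<le> p" "p \<le> 1"
  shows "unitary_mat d (reflect_mat d p)"
proof (rule unitary_mat_selfadjoint)
  show c: "reflect_mat d p \<in> carrier_mat d d" by (simp add: reflect_mat_def)
  show "mat_adjoint (reflect_mat d p) = reflect_mat d p"
    by (rule eq_matI) (auto simp: reflect_mat_def reflect_entry_def)
  \<comment> \<open>Only the first two summands of the matrix product mix basis states; the other
    \<open>e\<close> contribute the diagonal entry for \<open>i = j\<close>.\<close>
  obtain e where e: "d = Suc (Suc e)" using d by (metis le_add_diff_inverse numeral_2_eq_2 add_Suc add_0)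
  have sq: "complex_of_real (sqrt p) * complex_of_real (sqrt p) +
      complex_of_real (sqrt (1 - p)) * complex_of_real (sqrt (1 - p)) = 1"
    using p by (simp flip: of_real_mult of_real_add)
  show "reflect_mat d p * reflect_mat d p = 1\<^sub>m d"
  proof (rule eq_matI)
    fix i j assume "i < dim_row (1\<^sub>m d :: complex mat)" "j < dim_col (1\<^sub>m d :: complex mat)"
    hence ij: "i < d" "j < d" by simp_all
    have "(reflect_mat d p * reflect_mat d p) $$ (i, j) =
       (\<Sum>h<d. reflect_mat d p $$ (i, h) * reflect_mat d p $$ (h, j))"
      using c c ij by (rule index_mult_mat_sum)
    also have "\<dots> = (\<Sum>h<d. reflect_entry p i h * reflect_entry p h j)"
      using ij by (intro sum.cong) (simp_all add: reflect_mat_def)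
    also have "\<dots> = reflect_entry p i 0 * reflect_entry p 0 j + (reflect_entry p i 1 * reflect_entry p 1 j +
        (\<Sum>h<e. reflect_entry p i (Suc (Suc h)) * reflect_entry p (Suc (Suc h)) j))"
      unfolding e by (simp only: sum.lessThan_Suc_shift One_nat_def)
    also have "(\<Sum>h<e. reflect_entry p i (Suc (Suc h)) * reflect_entry p (Suc (Suc h)) j) =
       (\<Sum>h<e. if h = i - 2 then (if 2 \<le> i \<and> i = j then 1 else 0) else 0)"
      by (intro sum.cong refl) (auto simp: reflect_entry_def)
    also have "\<dots> = (if 2 \<le> i \<and> i = j then 1 else 0)"
      using ij e by auto
    also have "reflect_entry p i 0 * reflect_entry p 0 j + (reflect_entry p i 1 * reflect_entry p 1 j +
       (if 2 \<le> i \<and> i = j then 1 else 0)) = (if i = j then 1 else 0)"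
    proof (cases "i < 2 \<and> j < 2")
      case True
      hence "(i = 0 \<or> i = 1) \<and> (j = 0 \<or> j = 1)" by auto
      thus ?thesis using sq by (auto simp: reflect_entry_def algebra_simps)
    qed (auto simp: reflect_entry_def)
    finally show "(reflect_mat d p * reflect_mat d p) $$ (i, j) = 1\<^sub>m d $$ (i, j)"
      using ij by simp
  qed (simp_all add: reflect_mat_def)
qed

text \<open>With \<open>b = cos \<theta>\<close>, the recurrence is
  \<open>cos (a + \<theta>) + cos (a - \<theta>) = 2 b cos a\<close>. The sequence starts at
  \<open>cos \<theta>\<close>, hence the shift to \<open>t + 1\<close>.\<close>

lemma cos_recurrence:
  fixes y :: "nat \<Rightarrow> complex"
  assumes b: "\<bar>b\<bar> \<le> (1::real)" and "y 0 = of_real b" "y 1 = of_real (2 * b\<^sup>2 - 1)"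
    and rec: "\<And>t. y (t + 2) = 2 * of_real b * y (t + 1) - y t"
  shows "y t = of_real (cos (real (t + 1) * arccos b))"
proof -
  let ?\<theta> = "arccos b"
  have cb: "cos ?\<theta> = b" using b by (simp add: cos_arccos_abs)
  \<comment> \<open>Two consecutive values are carried along, as the recurrence has order
    two.\<close>
  have "y t = of_real (cos (real (t + 1) * ?\<theta>)) \<and> y (t + 1) = of_real (cos (real (t + 2) * ?\<theta>))"
  proof (induction t)
    case 0
    have "cos (2 * ?\<theta>) = 2 * b\<^sup>2 - 1" using cb by (simp add: cos_double_cos)
    then show ?case using assms cb by simp
  next
    case (Suc t)
    let ?a = "real (t + 2) * ?\<theta>"
    have e1: "real (Suc t + 2) * ?\<theta> = ?a + ?\<theta>" and e2: "real (t + 1) * ?\<theta> = ?a - ?\<theta>"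
      by (simp_all add: algebra_simps)
    have *: "cos (?a + ?\<theta>) = 2 * b * cos ?a - cos (?a - ?\<theta>)"
      using cb by (simp add: cos_add cos_diff)
    have "y (Suc t + 1) = 2 * of_real b * y (t + 1) - y t"
      using rec[of t] by (simp add: numeral_2_eq_2)
    also have "\<dots> = of_real (2 * b * cos ?a - cos (real (t + 1) * ?\<theta>))"
      using Suc by simp
    also have "\<dots> = of_real (cos (real (Suc t + 2) * ?\<theta>))"
      unfolding e1 e2 * ..
    finally show ?case using Suc by simp
  qed
  thus ?thesis by simp
qed

text \<open>The amplification operator \<open>G = R W\<close> is a product of two reflections, and
  \<open>G\<^sup>2 e\<^sub>0 = 2 b G e\<^sub>0 - e\<^sub>0\<close> with \<open>b = \<langle>e\<^sub>0, W e\<^sub>0\<rangle>\<close>: this is the Chebyshev recurrence.\<close>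

lemma reflection_product_power:
  fixes W :: "complex mat"
  assumes W: "W \<in> carrier_mat d d" and W2: "W * W = 1\<^sub>m d" and d: "0 < d"
    and b: "W $$ (0, 0) = of_real b" "\<bar>b\<bar> \<le> 1"
  shows "(W * (sign_mat d {0} * W) ^\<^sub>m t) $$ (0, 0) = of_real (cos (real (t + 1) * arccos b))"
proof -
  define R where "R = sign_mat d {0}"
  define G where "G = R * W"
  have R: "R \<in> carrier_mat d d" by (simp add: R_def)
  have G: "G \<in> carrier_mat d d" using R W by (simp add: G_def mult_carrier_mat[of _ d d])
  have Gp: "G ^\<^sub>m t \<in> carrier_mat d d" for t using G by (rule pow_carrier_mat)
  \<comment> \<open>\<open>R\<close> is twice the projection onto the initial state minus 1, so
    \<open>G\<close> maps this state to \<open>2 b\<close> times itself minus its image under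
    \<open>W\<close>.\<close>
  have G0: "G $$ (i, 0) = 2 * of_real b * (if i = 0 then 1 else 0) - W $$ (i, 0)" if "i < d" for i
    unfolding G_def R_def using W that d b by (simp add: index_sign_mat_mult[OF W] del: index_mult_mat)
  have AG: "(A * G) $$ (i, 0) = 2 * of_real b * A $$ (i, 0) - (A * W) $$ (i, 0)"
    if A: "A \<in> carrier_mat d d" and i: "i < d" for A i
  proof -
    have "(A * G) $$ (i, 0) = (\<Sum>h<d. A $$ (i, h) * G $$ (h, 0))"
      by (rule index_mult_mat_sum[OF A G i d])
    also have "\<dots> = (\<Sum>h<d. 2 * of_real b * (if h = 0 then A $$ (i, 0) else 0) - A $$ (i, h) * W $$ (h, 0))"
      by (intro sum.cong) (auto simp: G0 right_diff_distrib)
    also have "\<dots> = 2 * of_real b * A $$ (i, 0) - (A * W) $$ (i, 0)"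
      using d by (simp add: sum_subtractf sum_distrib_left[symmetric] index_mult_mat_sum[OF A W i d] del: index_mult_mat)
    finally show ?thesis .
  qed
  have GW: "G * W = R" unfolding G_def using R W W2
    by (simp add: assoc_mult_mat[of _ d d _ d _ d])
  have AR: "(A * R) $$ (i, 0) = A $$ (i, 0)" if A: "A \<in> carrier_mat d d" and i: "i < d" for A i
  proof -
    have "(A * R) $$ (i, 0) = (\<Sum>h<d. A $$ (i, h) * R $$ (h, 0))"
      by (rule index_mult_mat_sum[OF A R i d])
    also have "\<dots> = (\<Sum>h<d. if h = 0 then A $$ (i, 0) else 0)"
      using d by (intro sum.cong) (auto simp: R_def sign_mat_def)
    finally show ?thesis using d by simp
  qed
  \<comment> \<open>Apply \<open>AG\<close> to \<open>A * G\<close>: the remaining term is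
    \<open>A * G * W = A * R\<close>, and \<open>R\<close> fixes the initial state.\<close>
  have AGG: "(A * (G * G)) $$ (i, 0) = 2 * of_real b * (A * G) $$ (i, 0) - A $$ (i, 0)"
    if A: "A \<in> carrier_mat d d" and i: "i < d" for A i
  proof -
    have "(A * (G * G)) = (A * G) * G" using A G by (simp add: assoc_mult_mat[of _ d d _ d _ d])
    also have "\<dots> $$ (i, 0) = 2 * of_real b * (A * G) $$ (i, 0) - ((A * G) * W) $$ (i, 0)"
      using A G i by (intro AG) (simp_all add: mult_carrier_mat[of _ d d])
    also have "(A * G) * W = A * R" using A G W by (simp add: assoc_mult_mat[of _ d d _ d _ d] GW)
    finally show ?thesis using AR[OF A i] by simp
  qed
  have "(W * G ^\<^sub>m t) $$ (0, 0) = of_real (cos (real (t + 1) * arccos b))"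
  proof (rule cos_recurrence[OF b(2)])
    show "(W * G ^\<^sub>m 0) $$ (0, 0) = of_real b" using W G b by simp
    have "(W * G) $$ (0, 0) = of_real (2 * b\<^sup>2 - 1)"
      using AG[OF W d] W2 b d by (simp add: power2_eq_square del: index_mult_mat)
    thus "(W * G ^\<^sub>m 1) $$ (0, 0) = of_real (2 * b\<^sup>2 - 1)" using G by simp
    fix t
    have "W * G ^\<^sub>m (t + 2) = (W * G ^\<^sub>m t) * (G * G)"
      using W G Gp[of t] by (simp add: numeral_2_eq_2 assoc_mult_mat[of _ d d _ d _ d]
          mult_carrier_mat[of _ d d _ d])
    also have "\<dots> $$ (0, 0) = 2 * of_real b * ((W * G ^\<^sub>m t) * G) $$ (0, 0) - (W * G ^\<^sub>m t) $$ (0, 0)"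
      using W Gp d by (intro AGG) (simp_all add: mult_carrier_mat[of _ d d _ d])
    also have "(W * G ^\<^sub>m t) * G = W * G ^\<^sub>m (t + 1)"
      using W G Gp[of t] by (simp add: assoc_mult_mat[of _ d d _ d _ d])
    finally show "(W * G ^\<^sub>m (t + 2)) $$ (0, 0) =
      2 * of_real b * (W * G ^\<^sub>m (t + 1)) $$ (0, 0) - (W * G ^\<^sub>m t) $$ (0, 0)" .
  qed
  thus ?thesis by (simp add: G_def R_def)
qed

text \<open>For \<open>G = R * W\<close> the adjoint is \<open>W * R\<close>, and
  \<open>W * R * W * G = W * G * G\<close>; each factor on the left becomes one more power of
  \<open>G\<close> on the right. This brings the bias after \<open>s\<close> amplification steps
  into the form of \<open>reflection_product_power\<close>.\<close>

lemma conjugate_reflection_power: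
  fixes W :: "complex mat"
  assumes W: "W \<in> carrier_mat d d" and adj: "mat_adjoint W = W"
    and R: "R \<in> carrier_mat d d" "mat_adjoint R = R"
  shows "mat_adjoint ((R * W) ^\<^sub>m s) * (W * (R * W) ^\<^sub>m s) = W * (R * W) ^\<^sub>m (2 * s)"
proof -
  define G where "G = R * W"
  have G: "G \<in> carrier_mat d d" using R W by (simp add: G_def mult_carrier_mat[of _ d d])
  have Gp: "G ^\<^sub>m t \<in> carrier_mat d d" for t using G by (rule pow_carrier_mat)
  have Ga: "mat_adjoint G = W * R" using R W adj by (simp add: G_def mat_adjoint_mult[of _ d d _ d])
  \<comment> \<open>Matrix powers grow on the right, while the induction step below produces a
    factor on the left.\<close>
  have comm: "G * G ^\<^sub>m t = G ^\<^sub>m t * G" for t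
    by (induction t) (use G Gp in \<open>simp_all add: assoc_mult_mat[of _ d d _ d _ d, symmetric] del: assoc_mult_mat\<close>)
  have "mat_adjoint (G ^\<^sub>m s) * (W * G ^\<^sub>m s) = W * G ^\<^sub>m (2 * s)"
  proof (induction s)
    case 0
    then show ?case using W G by simp
  next
    case (Suc s)
    have c: "mat_adjoint (G ^\<^sub>m s) \<in> carrier_mat d d" "mat_adjoint G \<in> carrier_mat d d" using G Gp by simp_all
    have "mat_adjoint (G ^\<^sub>m Suc s) * (W * G ^\<^sub>m Suc s) =
       (mat_adjoint G * (mat_adjoint (G ^\<^sub>m s) * (W * G ^\<^sub>m s))) * G"
      using G Gp W c
      by (simp add: mat_adjoint_mult[of _ d d _ d] assoc_mult_mat[of _ d d _ d _ d] mult_carrier_mat[of _ d d _ d])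
    also have "\<dots> = (mat_adjoint G * (W * G ^\<^sub>m (2 * s))) * G" by (simp only: Suc)
    also have "\<dots> = W * ((G * G ^\<^sub>m (2 * s)) * G)"
      unfolding Ga using G Gp W R by (simp add: assoc_mult_mat[of _ d d _ d _ d]
          mult_carrier_mat[of _ d d _ d] G_def[symmetric]) (simp add: G_def assoc_mult_mat[of _ d d _ d _ d]
          mult_carrier_mat[of _ d d _ d] R W)
    also have "\<dots> = W * G ^\<^sub>m (2 * Suc s)" by (simp only: comm) simp
    finally show ?case .
  qed
  thus ?thesis by (simp add: G_def)
qed

section \<open>Composition and amplification of algorithms\<close>

lemma index_mult_unit_vec:
  fixes V :: "complex mat"
  assumes "V \<in> carrier_mat d d" "j < d"
  shows "vec_index (V *\<^sub>v unit_vec d 0) j = V $$ (j, 0)"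
proof -
  have "vec_index (V *\<^sub>v unit_vec d 0) j = (\<Sum>h<d. V $$ (j, h) * (if h = 0 then 1 else 0))"
    using assms by (auto simp: scalar_prod_def unit_vec_def atLeast0LessThan intro!: sum.cong)
  also have "\<dots> = (\<Sum>h<d. if h = 0 then V $$ (j, 0) else 0)"
    by (intro sum.cong) auto
  finally show ?thesis using assms by simp
qed

context query_model begin

definition realizable_at :: "nat \<Rightarrow> nat \<Rightarrow> (nat list \<Rightarrow> bool pmf) \<Rightarrow> bool" where
  "realizable_at m T F \<longleftrightarrow> (\<exists>V S. circuit m T V \<and>
     F = (\<lambda>x. bernoulli_pmf (col_prob (qdim k n m) S (V x))))"

definition realizable :: "nat \<Rightarrow> (nat list \<Rightarrow> bool pmf) \<Rightarrow> bool" where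
  "realizable T F \<longleftrightarrow> (\<exists>m>0. realizable_at m T F)"

lemma accept_prob_eq_col_prob:
  assumes V: "V x \<in> carrier_mat (qdim k n (alg_work A)) (qdim k n (alg_work A))"
    and "final_state k n A x = V x *\<^sub>v unit_vec (qdim k n (alg_work A)) 0"
  shows "accept_prob k n A x = col_prob (qdim k n (alg_work A)) (alg_accept A) (V x)"
  unfolding accept_prob_def col_prob_def using assms
  by (intro sum.cong) (auto simp: index_mult_unit_vec[OF V])

lemma circuit_of_alg:
  assumes A: "query_alg k n A"
  obtains W where "circuit (alg_work A) (queries A) W"
    "\<And>x. accept_prob k n A x = col_prob (qdim k n (alg_work A)) (alg_accept A) (W x)"
proof -
  let ?m = "alg_work A"
  have m: "0 < ?m" using A by (simp add: query_alg_def)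
  have "circuit ?m 0 (\<lambda>x. alg_init A)" using A by (intro circuit_0I) (simp add: query_alg_def)
  from circuit_of_rounds[OF m this, of "alg_rounds A"] A obtain W where
    W: "circuit ?m (queries A) W" "\<And>x. final_state k n A x = W x *\<^sub>v unit_vec (qdim k n ?m) 0"
    by (auto simp: query_alg_def final_state_def queries_def)
  show ?thesis
    by (rule that[OF W(1) accept_prob_eq_col_prob[where V = W, OF circuit_carrier[OF m W(1)] W(2)]])
qed

lemma accept_prob_bounds:
  assumes A: "query_alg k n A"
  shows "0 \<le> accept_prob k n A x" "accept_prob k n A x \<le> 1"
proof -
  have m: "0 < alg_work A" using A by (simp add: query_alg_def)
  obtain W where W: "circuit (alg_work A) (queries A) W"
    "\<And>x. accept_prob k n A x = col_prob (qdim k n (alg_work A)) (alg_accept A) (W x)"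
    using circuit_of_alg[OF A] by blast
  show "0 \<le> accept_prob k n A x" "accept_prob k n A x \<le> 1"
    unfolding W(2) by (rule col_prob_bounds[OF circuit_unitary[OF m W(1)] qdim_pos[OF m]])+
qed

lemma realizable_alg_output:
  assumes A: "query_alg k n A"
  shows "realizable (queries A) (alg_output k n A)"
proof -
  have m: "0 < alg_work A" using A by (simp add: query_alg_def)
  obtain W where W: "circuit (alg_work A) (queries A) W"
    "\<And>x. accept_prob k n A x = col_prob (qdim k n (alg_work A)) (alg_accept A) (W x)"
    using circuit_of_alg[OF A] by blast
  have "alg_output k n A = (\<lambda>x. bernoulli_pmf (col_prob (qdim k n (alg_work A)) (alg_accept A) (W x)))"
    unfolding alg_output_def W(2) ..
  thus ?thesis using m W(1) unfolding realizable_def realizable_at_def by blast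
qed

lemma realizable_imp_alg_output:
  assumes "realizable T F"
  shows "\<exists>A. query_alg k n A \<and> queries A = T \<and> alg_output k n A = F"
proof -
  from assms obtain m V S where m: "0 < m" and V: "circuit m T V"
    and F: "F = (\<lambda>x. bernoulli_pmf (col_prob (qdim k n m) S (V x)))"
    unfolding realizable_def realizable_at_def by blast
  from rounds_of_circuit[OF m V] obtain U Us where Us: "length Us = T"
    "\<forall>U \<in> insert U (set Us). unitary_mat (qdim k n m) U"
    "\<And>x. foldl (\<lambda>v U. U *\<^sub>v (oracle_mat k n m x *\<^sub>v v)) (U *\<^sub>v unit_vec (qdim k n m) 0) Us =
       V x *\<^sub>v unit_vec (qdim k n m) 0" by blast
  define A where "A = \<lparr>alg_work = m, alg_init = U, alg_rounds = Us, alg_accept = S\<rparr>"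
  have "query_alg k n A" "queries A = T" using m Us by (simp_all add: query_alg_def queries_def A_def)
  moreover have "accept_prob k n A x = col_prob (qdim k n m) S (V x)" for x
    using accept_prob_eq_col_prob[of V x A] circuit_carrier[OF m V, of x] Us(3)[of x]
    by (simp add: A_def final_state_def)
  hence "alg_output k n A = F" by (intro ext) (simp add: F alg_output_def)
  ultimately show ?thesis by blast
qed

text \<open>An idle extra register starts and stays in state 0, and acceptance is read off the old
  registers.\<close>

lemma realizable_at_mult:
  assumes m: "0 < m" "0 < l" and F: "realizable_at m T F"
  shows "realizable_at (m * l) T F"
proof -
  let ?d = "qdim k n m"
  from F obtain V S where V: "circuit m T V"
    and F: "F = (\<lambda>x. bernoulli_pmf (col_prob ?d S (V x)))"
    unfolding realizable_at_def by blast
  have d: "0 < ?d" using qdim_pos m by simp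
  let ?W = "\<lambda>x. mux ?d l (\<lambda>_. V x)"
  have "col_prob (?d * l) {c. c div l \<in> S} (?W x) = col_prob ?d S (V x)" for x
  proof -
    have "col_prob (?d * l) {c. c div l \<in> S} (?W x) =
      (\<Sum>a<?d. \<Sum>j<l. if j = 0 then (if a \<in> S then (cmod (V x $$ (a, 0)))\<^sup>2 else 0) else 0)"
      unfolding col_prob_alt sum_pair_index using m d
      by (intro sum.cong refl) (auto simp: pair_index_less)
    thus ?thesis using m by (simp add: col_prob_alt)
  qed
  moreover have "circuit (m * l) T ?W" using circuit_mux[OF m, of T "\<lambda>_. V"] V by simp
  ultimately show ?thesis unfolding realizable_at_def F
    by (intro exI[of _ ?W] exI[of _ "{c. c div l \<in> S}"]) (simp add: qdim_mult)
qed

text \<open>The first computation is moved into the workspace and controls which of the two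
  computations is run afterwards, so deferring its measurement does not change the outcome.\<close>

lemma realizable_at_bind:
  assumes m: "0 < m" and F: "realizable_at m T F" and G: "\<And>b. realizable_at m T' (G b)"
  shows "realizable (T' + T) (\<lambda>x. bind_pmf (F x) (\<lambda>b. G b x))"
proof -
  let ?d = "qdim k n m"
  have d: "0 < ?d" using qdim_pos m by simp
  from F obtain V S where V: "circuit m T V" and F: "F = (\<lambda>x. bernoulli_pmf (col_prob ?d S (V x)))"
    unfolding realizable_at_def by blast
  from G have "\<forall>b. \<exists>V S. circuit m T' V \<and> G b = (\<lambda>x. bernoulli_pmf (col_prob ?d S (V x)))"
    unfolding realizable_at_def by blast
  then obtain V' S' where V': "\<And>b. circuit m T' (V' b)"
    and G: "\<And>b. G b = (\<lambda>x. bernoulli_pmf (col_prob ?d (S' b) (V' b x)))" by metis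
  define P where "P = perm_mat (?d * ?d) (swap_index ?d)"
  have P: "unitary_mat (?d * ?d) P"
    unfolding P_def by (intro unitary_perm_mat[where \<tau> = "swap_index ?d"] swap_index_involution)
  \<comment> \<open>The first computation ends in the first factor. \<open>P\<close> moves its
    result to the second one, where it selects \<open>V' True\<close> or \<open>V' False\<close>,
    which runs in the first factor, now 0 again.\<close>
  define W where "W x = mux ?d ?d (\<lambda>j. V' (j \<in> S) x) * (P * mux ?d ?d (\<lambda>_. V x))" for x
  have md: "0 < m * ?d" using m d by simp
  have cW: "circuit (m * ?d) (T' + T) W"
    unfolding W_def
    by (intro circuit_mult[OF md] circuit_unitary_mult[OF md] circuit_mux m d V V')
      (simp add: qdim_mult P)
  \<comment> \<open>\<open>r div ?d\<close> is the outcome of the second computation,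
    \<open>r mod ?d\<close> that of the first.\<close>
  define A where "A = {r. r div ?d \<in> S' (r mod ?d \<in> S)}"
  have col: "W x $$ (a * ?d + j, 0) = V' (j \<in> S) x $$ (a, 0) * V x $$ (j, 0)"
    if "a < ?d" "j < ?d" for a j x
  proof -
    let ?B = "P * mux ?d ?d (\<lambda>_. V x)"
    have B: "?B \<in> carrier_mat (?d * ?d) (?d * ?d)"
      using P by (intro mult_carrier_mat[of _ _ "?d * ?d"]) simp_all
    have dd: "0 < ?d * ?d" using d by simp
    have Bi: "?B $$ (c * ?d + j, 0) = (if c = 0 then V x $$ (j, 0) else 0)" if c: "c < ?d" for c
    proof -
      have "?B $$ (c * ?d + j, 0) = mux ?d ?d (\<lambda>_. V x) $$ (swap_index ?d (c * ?d + j), 0)"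
        unfolding P_def using \<open>j < ?d\<close> c dd
        by (intro index_perm_mat_mult[OF mux_carrier] swap_index_involution) (simp_all add: pair_index_less)
      also have "\<dots> = (if c = 0 then V x $$ (j, 0) else 0)"
        using c \<open>j < ?d\<close> d by (simp add: swap_index_pair pair_index_less)
      finally show ?thesis .
    qed
    have "W x $$ (a * ?d + j, 0) = (\<Sum>c<?d. V' (j \<in> S) x $$ (a, c) * ?B $$ (c * ?d + j, 0))"
      unfolding W_def using that dd circuit_carrier[OF m V']
      by (subst index_mux_mult[OF _ B]) (simp_all add: pair_index_less)
    also have "\<dots> = (\<Sum>c<?d. if c = 0 then V' (j \<in> S) x $$ (a, 0) * V x $$ (j, 0) else 0)"
      using Bi by (intro sum.cong) auto
    finally show ?thesis using d by simp
  qed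
  have prob: "col_prob (?d * ?d) A (W x) =
     col_prob ?d S (V x) * col_prob ?d (S' True) (V' True x) +
     (1 - col_prob ?d S (V x)) * col_prob ?d (S' False) (V' False x)" for x
  proof -
    let ?v = "\<lambda>j. (cmod (V x $$ (j, 0)))\<^sup>2"
    let ?q = "\<lambda>b. col_prob ?d (S' b) (V' b x)"
    have "col_prob (?d * ?d) A (W x) =
      (\<Sum>a<?d. \<Sum>j<?d. ?v j * (if a \<in> S' (j \<in> S) then (cmod (V' (j \<in> S) x $$ (a, 0)))\<^sup>2 else 0))"
      unfolding col_prob_alt sum_pair_index
      by (intro sum.cong refl) (auto simp: A_def col norm_mult power_mult_distrib)
    also have "\<dots> = (\<Sum>j<?d. ?v j * ?q (j \<in> S))"
      unfolding col_prob_alt sum_distrib_left by (rule sum.swap)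
    also have "\<dots> = (\<Sum>j<?d. (if j \<in> S then ?v j else 0) * ?q True +
       (?v j - (if j \<in> S then ?v j else 0)) * ?q False)"
      by (intro sum.cong) auto
    also have "\<dots> = col_prob ?d S (V x) * ?q True + (1 - col_prob ?d S (V x)) * ?q False"
      using unitary_mat_col_norm[OF circuit_unitary[OF m V] d, of x]
      by (simp add: sum.distrib sum_distrib_right[symmetric] sum_subtractf col_prob_alt[symmetric])
    finally show ?thesis .
  qed
  have "(\<lambda>x. bind_pmf (F x) (\<lambda>b. G b x)) = (\<lambda>x. bernoulli_pmf (col_prob (qdim k n (m * ?d)) A (W x)))"
    unfolding F G qdim_mult prob
    by (intro ext bind_bernoulli_pmf col_prob_bounds d circuit_unitary[OF m V] circuit_unitary[OF m V'])
  thus ?thesis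
    using cW md unfolding realizable_def realizable_at_def by blast
qed

lemma realizable_bind:
  assumes F: "realizable T F" and G: "\<And>b. realizable T' (G b)"
  shows "realizable (T + T') (\<lambda>x. bind_pmf (F x) (\<lambda>b. G b x))"
proof -
  obtain m where m: "0 < m" "realizable_at m T F" using F unfolding realizable_def by blast
  obtain m1 where m1: "0 < m1" "realizable_at m1 T' (G True)" using G unfolding realizable_def by blast
  obtain m2 where m2: "0 < m2" "realizable_at m2 T' (G False)" using G unfolding realizable_def by blast
  define M where "M = m * (m1 * m2)"
  have e: "M = m1 * (m * m2)" "M = m2 * (m * m1)" by (simp_all add: M_def)
  have "realizable_at M T F" unfolding M_def using m m1 m2 by (intro realizable_at_mult) auto
  moreover have "realizable_at M T' (G b)" for b
    by (cases b; (simp, (subst e(1); intro realizable_at_mult; use m m1 m2 in simp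
      | subst e(2); intro realizable_at_mult; use m m1 m2 in simp)))
  moreover have "0 < M" using m m1 m2 by (simp add: M_def)
  ultimately show ?thesis using realizable_at_bind[of M T F T' G] by (simp add: add.commute)
qed

lemma realizable_bernoulli:
  assumes "0 \<le> p" "p \<le> 1"
  shows "realizable 0 (\<lambda>_. bernoulli_pmf p)"
proof -
  let ?d = "qdim k n 2"
  have d: "2 \<le> ?d" using k_pos by (simp add: qdim_def)
  have "circuit 2 0 (\<lambda>x. reflect_mat ?d p)" using unitary_reflect_mat[OF d assms] by (rule circuit_0I)
  moreover have "{0} \<inter> {..<?d} = {0}" using d by auto
  hence "col_prob ?d {0} (reflect_mat ?d p) = p"
    unfolding col_prob_def using assms d by (simp add: reflect_mat_def reflect_entry_def)
  ultimately show ?thesis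
    unfolding realizable_def realizable_at_def
    by (intro exI[of _ 2] conjI exI[of _ "\<lambda>x. reflect_mat ?d p"] exI[of _ "{0}"]) auto
qed

lemma realizable_return: "realizable 0 (\<lambda>_. return_pmf b)"
  using realizable_bernoulli[of 0] realizable_bernoulli[of 1]
  by (cases b) (simp_all add: bernoulli_pmf_0 bernoulli_pmf_1)

lemma realizable_trivial: "\<exists>F. realizable T F"
proof -
  let ?d = "qdim k n 1"
  have "\<exists>V. circuit 1 T V"
  proof (induction T)
    case 0
    then show ?case using circuit_0I[OF unitary_mat_one] by blast
  next
    case (Suc T)
    then show ?case using circuit_SucI[OF unitary_mat_one] by blast
  qed
  then obtain V where "circuit 1 T V" by blast
  hence "realizable_at 1 T (\<lambda>x. bernoulli_pmf (col_prob ?d {} (V x)))"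
    unfolding realizable_at_def by blast
  thus ?thesis unfolding realizable_def by (metis zero_less_Suc One_nat_def)
qed

text \<open>An algorithm with the missing \<open>T' - T\<close> queries is run first and its output
  is ignored.\<close>

lemma realizable_mono:
  assumes "realizable T F" "T \<le> T'"
  shows "realizable T' F"
proof -
  obtain F' where "realizable (T' - T) F'" using realizable_trivial by blast
  from realizable_bind[OF this, of T "\<lambda>_. F"] assms show ?thesis by simp
qed

text \<open>The reflection \<open>W = mat_adjoint V * Z * V\<close> has the bias
  \<open>cos \<theta>\<close> as its corner entry. Run \<open>V\<close> after \<open>s\<close> steps
  \<open>R * W\<close>: the new bias is the corner entry of
  \<open>W * (R * W) ^\<^sub>m (2 * s)\<close>, namely \<open>cos ((2 * s + 1) * \<theta>)\<close>.
  Each step uses \<open>V\<close> and its adjoint, so \<open>T + s * (T + T)\<close> queries are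
  made.\<close>

lemma realizable_amplify:
  assumes T: "realizable T (\<lambda>x. bernoulli_pmf (p x))" and p: "\<And>x. 0 \<le> p x" "\<And>x. p x \<le> 1"
  shows "realizable ((2 * s + 1) * T)
    (\<lambda>x. bernoulli_pmf ((1 + cos (real (2 * s + 1) * arccos (2 * p x - 1))) / 2))"
proof -
  from T obtain m V S where m: "0 < m" and V: "circuit m T V"
    and F: "(\<lambda>x. bernoulli_pmf (p x)) = (\<lambda>x. bernoulli_pmf (col_prob (qdim k n m) S (V x)))"
    unfolding realizable_def realizable_at_def by blast
  let ?d = "qdim k n m"
  have d: "0 < ?d" using qdim_pos m by simp
  note uV = circuit_unitary[OF m V]
  have cV: "V x \<in> carrier_mat ?d ?d" "mat_adjoint (V x) \<in> carrier_mat ?d ?d" for x using uV by simp_all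
  \<comment> \<open>Within the unit interval a Bernoulli distribution determines its
    parameter.\<close>
  have p_eq: "p x = col_prob ?d S (V x)" for x
  proof -
    have "bernoulli_pmf (p x) = bernoulli_pmf (col_prob ?d S (V x))" using F by meson
    hence "pmf (bernoulli_pmf (p x)) True = pmf (bernoulli_pmf (col_prob ?d S (V x))) True" by simp
    thus ?thesis using p col_prob_bounds[OF uV d] by simp
  qed
  define Z where "Z = sign_mat ?d S"
  define R where "R = sign_mat ?d {0}"
  define W where "W x = mat_adjoint (V x) * (Z * V x)" for x
  have Z: "unitary_mat ?d Z" "Z \<in> carrier_mat ?d ?d" "mat_adjoint Z = Z" "Z * Z = 1\<^sub>m ?d"
    by (simp_all add: Z_def mat_adjoint_sign_mat sign_mat_square)
  have R: "unitary_mat ?d R" "R \<in> carrier_mat ?d ?d" "mat_adjoint R = R"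
    by (simp_all add: R_def mat_adjoint_sign_mat)
  have cW: "circuit m (T + T) W"
    unfolding W_def by (intro circuit_mult[OF m] circuit_adjoint[OF m] circuit_unitary_mult[OF m] V Z)
  note W = circuit_carrier[OF m cW]
  have W_adj: "mat_adjoint (W x) = W x" for x
    unfolding W_def using cV[of x] Z
    by (simp add: mat_adjoint_mult[of _ ?d ?d _ ?d] mult_carrier_mat[of _ ?d ?d _ ?d]
        assoc_mult_mat[of _ ?d ?d _ ?d _ ?d])
  have W2: "W x * W x = 1\<^sub>m ?d" for x
    using circuit_unitary[OF m cW, of x] by (simp add: unitary_mat_def W_adj)
  have W00: "W x $$ (0, 0) = of_real (2 * p x - 1)" for x
    unfolding W_def Z_def p_eq by (rule col_prob_expectation[OF uV d])
  define G where "G x = R * W x" for x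
  have cG: "circuit m (T + T) G"
    unfolding G_def by (intro circuit_unitary_mult[OF m] R cW)
  have cGs: "circuit m (s * (T + T)) (\<lambda>x. G x ^\<^sub>m s)" for s
  proof (induction s)
    case 0
    have "(\<lambda>x. G x ^\<^sub>m 0) = (\<lambda>x. 1\<^sub>m ?d)"
      using circuit_carrier[OF m cG] by (intro ext) (metis carrier_matD(1) pow_mat.simps(1))
    then show ?case using circuit_0I[of m "1\<^sub>m ?d"] by simp
  next
    case (Suc s)
    from circuit_mult[OF m this cG] show ?case by (simp add: algebra_simps)
  qed
  let ?U = "\<lambda>x. V x * G x ^\<^sub>m s"
  have cU: "circuit m (T + s * (T + T)) ?U"
    by (intro circuit_mult[OF m] V cGs)
  have prob: "2 * col_prob ?d S (?U x) - 1 = cos (real (2 * s + 1) * arccos (2 * p x - 1))" for x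
  proof -
    note Gs = circuit_carrier[OF m cGs, of x s]
    hence Gs': "mat_adjoint (G x ^\<^sub>m s) \<in> carrier_mat ?d ?d" by simp
    have "of_real (2 * col_prob ?d S (?U x) - 1) = (mat_adjoint (?U x) * (Z * ?U x)) $$ (0, 0)"
      unfolding Z_def by (rule col_prob_expectation[symmetric, OF circuit_unitary[OF m cU] d])
    also have "mat_adjoint (?U x) * (Z * ?U x) = mat_adjoint (G x ^\<^sub>m s) * (W x * G x ^\<^sub>m s)"
      unfolding W_def using cV[of x] Z Gs Gs'
      by (simp add: mat_adjoint_mult[of _ ?d ?d _ ?d] mult_carrier_mat[of _ ?d ?d _ ?d]
        assoc_mult_mat[of _ ?d ?d _ ?d _ ?d])
    also have "\<dots> = W x * G x ^\<^sub>m (2 * s)"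
      unfolding G_def by (intro conjugate_reflection_power[where d = ?d] W W_adj R(2,3))
    also have "\<dots> $$ (0, 0) = of_real (cos (real (2 * s + 1) * arccos (2 * p x - 1)))"
      unfolding G_def R_def using p[of x]
      by (intro reflection_product_power[OF W W2 d W00]) (simp add: abs_le_iff)
    finally show ?thesis unfolding of_real_eq_iff .
  qed
  have "(\<lambda>x. bernoulli_pmf ((1 + cos (real (2 * s + 1) * arccos (2 * p x - 1))) / 2)) =
     (\<lambda>x. bernoulli_pmf (col_prob ?d S (?U x)))"
    by (intro ext arg_cong[of _ _ bernoulli_pmf]) (simp only: prob[symmetric], simp)
  moreover have "(2 * s + 1) * T = T + s * (T + T)" by (simp add: algebra_simps)
  ultimately show ?thesis
    unfolding realizable_def realizable_at_def using m cU by metis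
qed

end

section \<open>Estimating the bias of an algorithm\<close>

lemma sin_bounds:
  fixes x :: real
  assumes "0 \<le> x" "x \<le> 1"
  shows "x / 2 \<le> sin x" "sin x \<le> 2 * x"
proof -
  have "\<bar>sin x - x\<bar> \<le> \<bar>x\<bar> ^ 3 / 6"
    using Maclaurin_sin_bound[of x 3] by (simp add: eval_nat_numeral sin_coeff_def fact_numeral field_simps)
  moreover have "\<bar>x\<bar> ^ 3 \<le> x"
  proof -
    have "x ^ 3 \<le> x ^ 1" using assms by (intro power_decreasing) auto
    thus ?thesis using assms by simp
  qed
  ultimately show "x / 2 \<le> sin x" "sin x \<le> 2 * x" using assms by linarith+
qed

lemma arcsin_bounds:
  fixes y :: real
  assumes "0 \<le> y" "y \<le> 1 / 2"
  shows "y / 2 \<le> arcsin y" "arcsin y \<le> 2 * y"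
proof -
  \<comment> \<open>The value at 1/2 is at most 1, the range in which \<open>sin_bounds\<close>
    applies.\<close>
  have "arcsin y \<le> arcsin (1 / 2)" using assms by (intro arcsin_le_arcsin) auto
  also have "arcsin (1 / 2 :: real) = pi / 6"
    using arcsin_sin[of "pi / 6"] by (simp add: sin_30)
  also have "\<dots> \<le> 1" using pi_less_4 by simp
  finally have le: "arcsin y \<le> 1" .
  have ge: "0 \<le> arcsin y" using arcsin_le_arcsin[of 0 y] assms by simp
  have "sin (arcsin y) = y" using assms by simp
  thus "y / 2 \<le> arcsin y" "arcsin y \<le> 2 * y" using sin_bounds[OF ge le] by simp_all
qed

text \<open>A multiplier congruent to 1 modulo 4 maps the angle \<open>pi / 2\<close> to itself
  modulo \<open>2 * pi\<close>. The amplified bias is therefore an odd function of \<open>y\<close>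
  that keeps the sign of \<open>y\<close> near 0.\<close>

lemma cos_odd_multiple_arccos:
  fixes y :: real
  assumes "\<bar>y\<bar> \<le> 1"
  shows "cos (real (4 * r + 1) * arccos y) = sin (real (4 * r + 1) * arcsin y)"
proof -
  have "arccos y = pi / 2 - arcsin y"
    using assms by (intro arccos_unique) (auto simp: abs_le_iff cos_diff arcsin_lbound arcsin_ubound
      dest: arcsin_bounded[of y])
  hence "real (4 * r + 1) * arccos y = real (4 * r + 1) * (pi / 2 - arcsin y)" by simp
  hence "real (4 * r + 1) * arccos y = pi / 2 - real (4 * r + 1) * arcsin y + 2 * real r * pi"
    by (simp add: algebra_simps)
  moreover have "cos (2 * real r * pi) = 1" "sin (2 * real r * pi) = 0"
    using cos_2npi[of r] sin_2npi[of r] by (simp_all add: mult_ac)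
  ultimately have "cos (real (4 * r + 1) * arccos y) = cos (pi / 2 - real (4 * r + 1) * arcsin y)"
    by (simp only: cos_add)
  thus ?thesis by (simp add: cos_diff)
qed

text \<open>The choice of \<open>r\<close> makes \<open>(4 * r + 1) * arcsin y\<close> of constant size at the ends of the interval.\<close>

lemma amplification_factor:
  assumes "0 < l" "l \<le> (1::real)"
  obtains r :: nat where "real (4 * r + 1) \<le> 1 / l" "1 / (5 * l) \<le> real (4 * r + 1)"
proof -
  define r where "r = nat \<lfloor>(1 / l - 1) / 4\<rfloor>"
  have 1: "1 \<le> 1 / l" using assms by simp
  hence "0 \<le> (1 / l - 1) / 4" by simp
  hence r: "real r \<le> (1 / l - 1) / 4" "(1 / l - 1) / 4 < real r + 1"
    unfolding r_def by linarith+
  have "real (4 * r + 1) \<le> 1 / l" using r by simp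
  moreover have "(1 / l) / 5 \<le> real (4 * r + 1)" using r 1 by simp
  ultimately show ?thesis using that[of r] by simp
qed

text \<open>Union bound: either the first sample is bad, or it is good and the second stage
  fails.\<close>

lemma prob_bind_pmf_le:
  assumes D: "measure_pmf.prob D {a. \<not> P a} \<le> \<delta>" and E: "\<And>a. P a \<Longrightarrow> measure_pmf.prob (E a) B \<le> \<epsilon>"
    and "0 \<le> \<epsilon>"
  shows "measure_pmf.prob (bind_pmf D E) B \<le> \<delta> + \<epsilon>"
proof -
  have \<delta>: "0 \<le> \<delta>" using D measure_nonneg order_trans by blast
  have "emeasure (measure_pmf (bind_pmf D E)) B = (\<integral>\<^sup>+a. emeasure (measure_pmf (E a)) B \<partial>measure_pmf D)"
    by simp
  also have "\<dots> \<le> (\<integral>\<^sup>+a. indicator {a. \<not> P a} a + ennreal \<epsilon> \<partial>measure_pmf D)"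
  proof (intro nn_integral_mono)
    fix a
    show "emeasure (measure_pmf (E a)) B \<le> indicator {a. \<not> P a} a + ennreal \<epsilon>"
    proof (cases "P a")
      case True
      thus ?thesis using E[OF True] by (simp add: measure_pmf.emeasure_eq_measure ennreal_leI)
    next
      case False
      have "emeasure (measure_pmf (E a)) B \<le> 1" by (rule measure_pmf.emeasure_le_1)
      also have "1 \<le> 1 + ennreal \<epsilon>" by simp
      finally show ?thesis using False by simp
    qed
  qed
  also have "\<dots> = emeasure (measure_pmf D) {a. \<not> P a} + ennreal \<epsilon>"
    by (simp add: nn_integral_add)
  also have "\<dots> = ennreal (measure_pmf.prob D {a. \<not> P a} + \<epsilon>)"
    using assms by (simp add: measure_pmf.emeasure_eq_measure)
  also have "\<dots> \<le> ennreal (\<delta> + \<epsilon>)" using D by (intro ennreal_leI) simp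
  finally show ?thesis
    using \<delta> \<open>0 \<le> \<epsilon>\<close> by (simp add: measure_pmf.emeasure_eq_measure del: ennreal_plus)
qed

text \<open>Hoeffding's inequality for a vote of \<open>N\<close> samples; a tie counts as
  \<open>False\<close>.\<close>

lemma binomial_majority:
  assumes q: "0 \<le> q" "q \<le> 1" and N: "0 < N" and \<eta>: "0 \<le> \<eta>"
  shows "1 / 2 + \<eta> \<le> q \<Longrightarrow>
      measure_pmf.prob (map_pmf (\<lambda>j. N < 2 * j) (binomial_pmf N q)) {False} \<le> exp (- 2 * real N * \<eta>\<^sup>2)"
    and "q \<le> 1 / 2 - \<eta> \<Longrightarrow>
      measure_pmf.prob (map_pmf (\<lambda>j. N < 2 * j) (binomial_pmf N q)) {True} \<le> exp (- 2 * real N * \<eta>\<^sup>2)"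
proof -
  interpret binomial_distribution N q by unfold_locales (use q in auto)
  assume q': "1 / 2 + \<eta> \<le> q"
  have half: "real x / real N \<le> 1 / 2" if "\<not> N < 2 * x" for x
    using that N by (simp add: field_simps)
  have "real x / real N \<le> q - \<eta>" if "\<not> N < 2 * x" for x
    using half[OF that] q' by linarith
  hence "measure_pmf.prob (map_pmf (\<lambda>j. N < 2 * j) (binomial_pmf N q)) {False} \<le>
      measure_pmf.prob (binomial_pmf N q) {x. real x / real N \<le> q - \<eta>}"
    by (simp add: vimage_def) (intro measure_pmf.finite_measure_mono, auto)
  thus "measure_pmf.prob (map_pmf (\<lambda>j. N < 2 * j) (binomial_pmf N q)) {False} \<le> exp (- 2 * real N * \<eta>\<^sup>2)"
    using prob_le'[OF N \<eta>] by simp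
next
  interpret binomial_distribution N q by unfold_locales (use q in auto)
  assume q': "q \<le> 1 / 2 - \<eta>"
  have half: "1 / 2 \<le> real x / real N" if "N < 2 * x" for x
    using that N by (simp add: field_simps)
  have "real x / real N \<ge> q + \<eta>" if "N < 2 * x" for x
    using half[OF that] q' by linarith
  hence "measure_pmf.prob (map_pmf (\<lambda>j. N < 2 * j) (binomial_pmf N q)) {True} \<le>
      measure_pmf.prob (binomial_pmf N q) {x. real x / real N \<ge> q + \<eta>}"
    by (simp add: vimage_def) (intro measure_pmf.finite_measure_mono, auto)
  thus "measure_pmf.prob (map_pmf (\<lambda>j. N < 2 * j) (binomial_pmf N q)) {True} \<le> exp (- 2 * real N * \<eta>\<^sup>2)"
    using prob_ge'[OF N \<eta>] by simp
qed

section \<open>Sampling of intermediate results and the search for the bias\<close>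

context query_model begin

text \<open>Algorithms only have Boolean outputs, so sampling from a distribution on another type is
  expressed by passing the sample on to an arbitrary family of further algorithms.\<close>

definition samplable :: "nat \<Rightarrow> (nat list \<Rightarrow> 'a pmf) \<Rightarrow> bool" where
  "samplable T D \<longleftrightarrow> (\<forall>T' h. (\<forall>a. realizable T' (h a)) \<longrightarrow>
     realizable (T + T') (\<lambda>x. bind_pmf (D x) (\<lambda>a. h a x)))"

lemma samplableD:
  "samplable T D \<Longrightarrow> (\<And>a. realizable T' (h a)) \<Longrightarrow>
    realizable (T + T') (\<lambda>x. bind_pmf (D x) (\<lambda>a. h a x))"
  by (simp add: samplable_def)

lemma samplable_return: "samplable 0 (\<lambda>_. return_pmf a)"
  by (simp add: samplable_def bind_return_pmf)

lemma samplable_bind: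
  fixes E :: "'a \<Rightarrow> nat list \<Rightarrow> 'b pmf"
  assumes D: "samplable T D" and E: "\<And>a. samplable T' (E a)"
  shows "samplable (T + T') (\<lambda>x. bind_pmf (D x) (\<lambda>a. E a x))"
  unfolding samplable_def
proof (intro allI impI)
  fix T'' and h :: "'b \<Rightarrow> nat list \<Rightarrow> bool pmf"
  assume h: "\<forall>a. realizable T'' (h a)"
  have "realizable (T' + T'') (\<lambda>x. bind_pmf (E a x) (\<lambda>b. h b x))" for a
    using E h by (intro samplableD) auto
  hence "realizable (T + (T' + T'')) (\<lambda>x. bind_pmf (D x) (\<lambda>a. bind_pmf (E a x) (\<lambda>b. h b x)))"
    by (intro samplableD[OF D, where h = "\<lambda>a x. bind_pmf (E a x) (\<lambda>b. h b x)"])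
  thus "realizable (T + T' + T'') (\<lambda>x. bind_pmf (bind_pmf (D x) (\<lambda>a. E a x)) (\<lambda>a. h a x))"
    by (simp add: bind_assoc_pmf add.assoc)
qed

lemma samplable_realizable: "realizable T F \<Longrightarrow> samplable T F"
  unfolding samplable_def using realizable_bind by blast

lemma realizable_samplable: "samplable T D \<Longrightarrow> realizable T D"
  using samplableD[of T D 0 "\<lambda>a _. return_pmf a", OF _ realizable_return]
  by (simp add: bind_return_pmf')

lemma samplable_map: "samplable T D \<Longrightarrow> samplable T (\<lambda>x. map_pmf f (D x))"
  using samplable_bind[of T D 0 "\<lambda>a _. return_pmf (f a)", OF _ samplable_return]
  by (simp add: map_pmf_def)

lemma samplable_mono: "samplable T D \<Longrightarrow> T \<le> T' \<Longrightarrow> samplable T' D"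
  unfolding samplable_def by (meson add_le_mono1 realizable_mono)

lemma samplable_binomial:
  assumes T: "realizable T (\<lambda>x. bernoulli_pmf (p x))" and p: "\<And>x. 0 \<le> p x" "\<And>x. p x \<le> 1"
  shows "samplable (N * T) (\<lambda>x. binomial_pmf N (p x))"
proof (induction N)
  case 0
  then show ?case using samplable_return[of 0] p by (simp add: binomial_pmf_0)
next
  case (Suc N)
  have "samplable (T + N * T) (\<lambda>x. bind_pmf (bernoulli_pmf (p x))
      (\<lambda>b. map_pmf (\<lambda>k. (if b then 1 else 0) + k) (binomial_pmf N (p x))))"
    by (intro samplable_bind samplable_realizable[OF T] samplable_map Suc)
  then show ?case using p by (simp add: binomial_pmf_Suc map_pmf_def)
qed

text \<open>One round of the search: is the bias above or below the centre \<open>c\<close>, with no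
  guarantee in the middle third. \<open>T'\<close> is chosen before \<open>c\<close>, so that the
  tests for all centres have the same number of queries and can follow a sampled
  \<open>c\<close>.\<close>

lemma threshold_test:
  assumes T: "realizable T (\<lambda>x. bernoulli_pmf (p x))" and p: "\<And>x. 0 \<le> p x" "\<And>x. p x \<le> 1"
    and l: "0 < l" "l \<le> 1" and L: "1 \<le> L"
  shows "\<exists>T'. real T' \<le> 28801 * real T * L / l \<and> (\<forall>c. \<bar>c\<bar> \<le> 1 \<longrightarrow> (\<exists>F. realizable T' F \<and>
    (\<forall>x. \<bar>2 * p x - 1 - c\<bar> \<le> l \<longrightarrow>
      (c + l / 3 \<le> 2 * p x - 1 \<longrightarrow> measure_pmf.prob (F x) {False} \<le> exp (- L)) \<and>
      (2 * p x - 1 \<le> c - l / 3 \<longrightarrow> measure_pmf.prob (F x) {True} \<le> exp (- L)))))"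
proof -
  obtain r where r: "real (4 * r + 1) \<le> 1 / l" "1 / (5 * l) \<le> real (4 * r + 1)"
    using amplification_factor[OF l] .
  define M where "M = 4 * r + 1"
  have Meq: "M = 2 * (2 * r) + 1" by (simp add: M_def)
  \<comment> \<open>Hoeffding's inequality for an advantage of \<open>1 / 240\<close>, where \<open>28800 = 240\<^sup>2 / 2\<close>.\<close>
  define N where "N = nat \<lceil>28800 * L\<rceil>"
  have N: "28800 * L \<le> real N" "real N \<le> 28801 * L" unfolding N_def using L by linarith+
  have N0: "0 < N" using N L by (cases N) auto
  have cost: "real (N * (M * T)) \<le> 28801 * real T * L / l"
  proof -
    have "real N * real M \<le> (28801 * L) * (1 / l)"
      using N r L by (intro mult_mono) (auto simp: M_def)
    hence "(real N * real M) * real T \<le> ((28801 * L) * (1 / l)) * real T" by (intro mult_right_mono) auto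
    thus ?thesis by (simp add: algebra_simps)
  qed
  have ex: "exp (- 2 * real N * (1 / 240)\<^sup>2) \<le> exp (- L)"
    using N by (simp add: power2_eq_square)
  have "\<exists>F. realizable (N * (M * T)) F \<and>
    (\<forall>x. \<bar>2 * p x - 1 - c\<bar> \<le> l \<longrightarrow>
      (c + l / 3 \<le> 2 * p x - 1 \<longrightarrow> measure_pmf.prob (F x) {False} \<le> exp (- L)) \<and>
      (2 * p x - 1 \<le> c - l / 3 \<longrightarrow> measure_pmf.prob (F x) {True} \<le> exp (- L)))"
    if c: "\<bar>c\<bar> \<le> 1" for c
  proof -
    \<comment> \<open>The added coin has bias \<open>-c\<close>, so the mixture has bias
      \<open>(2 * p x - 1 - c) / 2\<close>.\<close>
    define u where "u x = (p x + (1 - c) / 2) / 2" for x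
    have u: "0 \<le> u x" "u x \<le> 1" for x using p[of x] c by (auto simp: u_def field_simps abs_le_iff)
    have "realizable (0 + T) (\<lambda>x. bind_pmf (bernoulli_pmf (1 / 2))
        (\<lambda>b. (\<lambda>b x. bernoulli_pmf (if b then p x else (1 - c) / 2)) b x))"
    proof (intro realizable_bind realizable_bernoulli)
      fix b
      have "realizable T (\<lambda>_. bernoulli_pmf ((1 - c) / 2))"
        by (rule realizable_mono[OF realizable_bernoulli]) (use c in \<open>auto simp: abs_le_iff\<close>)
      thus "realizable T (\<lambda>x. bernoulli_pmf (if b then p x else (1 - c) / 2))"
        using T by (cases b) simp_all
    qed simp_all
    also have "(\<lambda>x. bind_pmf (bernoulli_pmf (1 / 2)) (\<lambda>b. bernoulli_pmf (if b then p x else (1 - c) / 2))) =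
        (\<lambda>x. bernoulli_pmf (u x))"
      using p c by (intro ext, subst bind_bernoulli_pmf) (auto simp: abs_le_iff u_def add_divide_distrib)
    finally have "realizable T (\<lambda>x. bernoulli_pmf (u x))" by simp
    note amp = realizable_amplify[OF this u, of "2 * r", folded Meq]
    define y where "y x = (2 * p x - 1 - c) / 2" for x
    have y: "2 * u x - 1 = y x" for x by (simp add: u_def y_def field_simps)
    define q where "q x = (1 + cos (real M * arccos (y x))) / 2" for x
    have "0 \<le> (1 + cos t) / 2" for t :: real using add_left_mono[OF cos_ge_minus_one[of t], of 1] by simp
    moreover have "(1 + cos t) / 2 \<le> 1" for t :: real using add_left_mono[OF cos_le_one[of t], of 1] by simp
    ultimately have q: "0 \<le> q x" "q x \<le> 1" for x by (simp_all only: q_def)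
    have "realizable (M * T) (\<lambda>x. bernoulli_pmf (q x))"
      using amp unfolding y q_def .
    from samplable_map[OF samplable_binomial[OF this q, of N]]
    have F: "realizable (N * (M * T)) (\<lambda>x. map_pmf (\<lambda>j. N < 2 * j) (binomial_pmf N (q x)))"
      by (intro realizable_samplable)
    \<comment> \<open>The two bounds on \<open>arcsin t\<close> put \<open>real M * arcsin t\<close>
      between 1/60 and 1, where the sine is at least half its argument. A bias of 1/120 is an
      advantage of 1/240 over a fair coin.\<close>
    have key: "1 / 120 \<le> sin (real M * arcsin t)" if t: "l / 6 \<le> t" "t \<le> l / 2" for t
    proof -
      have t2: "0 \<le> t" "t \<le> 1 / 2" using t l by auto
      note as = arcsin_bounds[OF t2]
      have "real M * arcsin t \<le> (1 / l) * l"
        using r as t t2 l by (intro mult_mono) (auto simp: M_def)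
      hence 1: "real M * arcsin t \<le> 1" using l by simp
      have "(1 / (5 * l)) * (l / 12) \<le> real M * arcsin t"
        using r as t t2 l by (intro mult_mono) (auto simp: M_def)
      hence 2: "1 / 60 \<le> real M * arcsin t" using l by simp
      from sin_bounds(1)[of "real M * arcsin t"] 1 2 show ?thesis by simp
    qed
    have q_eq: "q x = (1 + sin (real M * arcsin (y x))) / 2" if "\<bar>y x\<bar> \<le> l / 2" for x
      unfolding q_def M_def using that l by (subst cos_odd_multiple_arccos) auto
    have "\<forall>x. \<bar>2 * p x - 1 - c\<bar> \<le> l \<longrightarrow>
      (c + l / 3 \<le> 2 * p x - 1 \<longrightarrow>
        measure_pmf.prob (map_pmf (\<lambda>j. N < 2 * j) (binomial_pmf N (q x))) {False} \<le> exp (- L)) \<and>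
      (2 * p x - 1 \<le> c - l / 3 \<longrightarrow>
        measure_pmf.prob (map_pmf (\<lambda>j. N < 2 * j) (binomial_pmf N (q x))) {True} \<le> exp (- L))"
    proof (intro allI impI conjI)
      fix x assume a: "\<bar>2 * p x - 1 - c\<bar> \<le> l" "c + l / 3 \<le> 2 * p x - 1"
      hence "1 / 120 \<le> sin (real M * arcsin (y x))" by (intro key) (auto simp: y_def abs_le_iff)
      hence *: "1 / 2 + 1 / 240 \<le> q x" using a by (subst q_eq) (auto simp: y_def)
      show "measure_pmf.prob (map_pmf (\<lambda>j. N < 2 * j) (binomial_pmf N (q x))) {False} \<le> exp (- L)"
        by (rule order_trans[OF binomial_majority(1)[OF q N0] ex]) (use * in simp_all)
    next
      fix x assume a: "\<bar>2 * p x - 1 - c\<bar> \<le> l" "2 * p x - 1 \<le> c - l / 3"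
      have "- y x = (c - (2 * p x - 1)) / 2" by (simp add: y_def minus_divide_left)
      hence "l / 6 \<le> - y x" "- y x \<le> l / 2" using a by (simp_all add: abs_le_iff)
      hence "1 / 120 \<le> sin (real M * arcsin (- y x))" by (rule key)
      also have "arcsin (- y x) = - arcsin (y x)"
        using a l by (intro arcsin_minus) (auto simp: y_def abs_le_iff)
      finally have *: "q x \<le> 1 / 2 - 1 / 240" using a by (subst q_eq) (auto simp: y_def)
      show "measure_pmf.prob (map_pmf (\<lambda>j. N < 2 * j) (binomial_pmf N (q x))) {True} \<le> exp (- L)"
        by (rule order_trans[OF binomial_majority(2)[OF q N0] ex]) (use * in simp_all)
    qed
    thus ?thesis using F by blast
  qed
  thus ?thesis using cost by blast
qed

text \<open>Each round shrinks the radius of the interval by \<open>2/3\<close>; the failure probabilities of the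
  earlier (cheaper) rounds decrease geometrically, so that the cost is dominated by the last round.\<close>

lemma estimate_refine:
  assumes T: "realizable T (\<lambda>x. bernoulli_pmf (p x))" and p: "\<And>x. 0 \<le> p x" "\<And>x. p x \<le> 1"
    and L: "4 \<le> L"
  shows "\<exists>T' D. samplable T' D \<and> real T' \<le> 144005 * real T * (3 / 2) ^ s * L \<and>
    (\<forall>x. measure_pmf.prob (D x) {c. \<not> (\<bar>c\<bar> \<le> 1 - (2 / 3) ^ s \<and> \<bar>2 * p x - 1 - c\<bar> \<le> (2 / 3) ^ s)} \<le> exp (- L))"
  using L
proof (induction s arbitrary: L)
  case 0
  \<comment> \<open>Centre 0 and radius 1, as every bias lies between -1 and 1.\<close>
  have "{c. \<not> (\<bar>c\<bar> \<le> 1 - (2 / 3) ^ 0 \<and> \<bar>2 * p x - 1 - c\<bar> \<le> (2 / 3 :: real) ^ 0)} = {c. c \<noteq> 0}" for x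
    using p[of x] by (auto simp: abs_le_iff)
  hence "measure_pmf.prob (return_pmf 0)
      {c. \<not> (\<bar>c\<bar> \<le> 1 - (2 / 3) ^ 0 \<and> \<bar>2 * p x - 1 - c\<bar> \<le> (2 / 3 :: real) ^ 0)} \<le> exp (- L)" for x
    by simp
  moreover have "real 0 \<le> 144005 * real T * (3 / 2) ^ 0 * L" using 0 by simp
  ultimately show ?case using samplable_return[of 0]
    by (intro exI[of _ 0] exI[of _ "\<lambda>_. return_pmf 0"] conjI allI)
next
  case (Suc s)
  let ?l = "(2 / 3 :: real) ^ s"
  let ?P = "\<lambda>s x c. \<bar>c\<bar> \<le> 1 - (2 / 3 :: real) ^ s \<and> \<bar>2 * p x - 1 - c\<bar> \<le> (2 / 3) ^ s"
  have l: "0 < ?l" "?l \<le> 1" by (simp_all add: power_le_one)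
  have L1: "4 \<le> L + 1" "1 \<le> L + 1" using Suc.prems by simp_all
  from Suc.IH[OF L1(1)] obtain T1 D where D: "samplable T1 D"
    "real T1 \<le> 144005 * real T * (3 / 2) ^ s * (L + 1)"
    "\<And>x. measure_pmf.prob (D x) {c. \<not> ?P s x c} \<le> exp (- (L + 1))" by blast
  from threshold_test[OF T p l L1(2)] obtain T2 where
    T2: "real T2 \<le> 28801 * real T * (L + 1) / ?l" and F_ex:
    "\<forall>c. \<bar>c\<bar> \<le> 1 \<longrightarrow> (\<exists>F. realizable T2 F \<and>
    (\<forall>x. \<bar>2 * p x - 1 - c\<bar> \<le> ?l \<longrightarrow>
      (c + ?l / 3 \<le> 2 * p x - 1 \<longrightarrow> measure_pmf.prob (F x) {False} \<le> exp (- (L + 1))) \<and>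
      (2 * p x - 1 \<le> c - ?l / 3 \<longrightarrow> measure_pmf.prob (F x) {True} \<le> exp (- (L + 1)))))"
    by (elim exE conjE) (rule that)
  obtain F where F: "\<And>c. \<bar>c\<bar> \<le> 1 \<Longrightarrow> realizable T2 (F c)"
    "\<And>c x. \<bar>c\<bar> \<le> 1 \<Longrightarrow> \<bar>2 * p x - 1 - c\<bar> \<le> ?l \<Longrightarrow> c + ?l / 3 \<le> 2 * p x - 1 \<Longrightarrow>
       measure_pmf.prob (F c x) {False} \<le> exp (- (L + 1))"
    "\<And>c x. \<bar>c\<bar> \<le> 1 \<Longrightarrow> \<bar>2 * p x - 1 - c\<bar> \<le> ?l \<Longrightarrow> 2 * p x - 1 \<le> c - ?l / 3 \<Longrightarrow>
       measure_pmf.prob (F c x) {True} \<le> exp (- (L + 1))"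
    using F_ex by metis
  \<comment> \<open>\<open>samplable_bind\<close> asks for a continuation at every \<open>c\<close>;
    for \<open>c\<close> outside the invariant, where no test is available, the value is passed on
    unchanged.\<close>
  define E where "E c x = (if \<bar>c\<bar> \<le> 1 then
      map_pmf (\<lambda>v. if v then c + ?l / 3 else c - ?l / 3) (F c x) else return_pmf c)" for c x
  have E: "samplable T2 (E c)" for c
  proof (cases "\<bar>c\<bar> \<le> 1")
    case True
    thus ?thesis using samplable_map[OF samplable_realizable[OF F(1)[OF True]]]
      by (simp add: E_def[abs_def])
  next
    case False
    thus ?thesis using samplable_mono[OF samplable_return] by (simp add: E_def[abs_def])
  qed
  have "measure_pmf.prob (E c x) {c. \<not> ?P (Suc s) x c} \<le> exp (- (L + 1))" if c: "?P s x c" for c x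
  proof -
    have c1: "\<bar>c\<bar> \<le> 1" using c l by linarith
    have cs: "\<bar>2 * p x - 1 - c\<bar> \<le> ?l" using c by simp
    have cb: "\<bar>c\<bar> \<le> 1 - ?l" and e: "(2 / 3 :: real) ^ Suc s = ?l * 2 / 3" using c by simp_all
    \<comment> \<open>Moving the centre by a third of the radius is right unless the bias lies in
      the opposite outer third, and there the test is reliable. In the middle third both moves are
      right.\<close>
    have up: "?P (Suc s) x (c + ?l / 3)" if "c - ?l / 3 < 2 * p x - 1"
      unfolding e using cb cs that l by (intro conjI; linarith)
    have dn: "?P (Suc s) x (c - ?l / 3)" if "2 * p x - 1 < c + ?l / 3"
      unfolding e using cb cs that l by (intro conjI; linarith)
    let ?V = "{v. \<not> ?P (Suc s) x (if v then c + ?l / 3 else c - ?l / 3)}"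
    have "measure_pmf.prob (E c x) {c. \<not> ?P (Suc s) x c} = measure_pmf.prob (F c x) ?V"
      using c1 by (simp add: E_def vimage_def)
    also have "\<dots> \<le> exp (- (L + 1))"
    proof (cases "c + ?l / 3 \<le> 2 * p x - 1")
      case True
      hence "c - ?l / 3 < 2 * p x - 1" using l by linarith
      hence "?V \<subseteq> {False}" using up by auto
      hence "measure_pmf.prob (F c x) ?V \<le> measure_pmf.prob (F c x) {False}"
        by (intro measure_pmf.finite_measure_mono) auto
      thus ?thesis using F(2)[OF c1 cs True] by linarith
    next
      case False
      hence d: "?P (Suc s) x (c - ?l / 3)" using dn by linarith
      show ?thesis
      proof (cases "2 * p x - 1 \<le> c - ?l / 3")
        case True
        have "?V \<subseteq> {True}" using d by auto
        hence "measure_pmf.prob (F c x) ?V \<le> measure_pmf.prob (F c x) {True}"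
          by (intro measure_pmf.finite_measure_mono) auto
        thus ?thesis using F(3)[OF c1 cs True] by linarith
      next
        case False
        hence "?V = {}" using d up by (auto split: if_splits)
        thus ?thesis by simp
      qed
    qed
    finally show ?thesis .
  qed
  hence "measure_pmf.prob (bind_pmf (D x) (\<lambda>c. E c x)) {c. \<not> ?P (Suc s) x c} \<le> exp (- (L + 1)) + exp (- (L + 1))" for x
    by (intro prob_bind_pmf_le[OF D(3)[of x]]) auto
  \<comment> \<open>Raising \<open>L\<close> by 1 pays for the union bound over the two stages, as
    \<open>exp 1\<close> is at least 2.\<close>
  moreover have "exp (- (L + 1)) + exp (- (L + 1)) \<le> exp (- L)"
  proof -
    have "2 \<le> exp (1 :: real)" using exp_ge_add_one_self[of 1] by simp
    hence "exp (- (L + 1)) * 2 \<le> exp (- (L + 1)) * exp 1" by (intro mult_left_mono) auto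
    also have "\<dots> = exp (- L)" by (simp flip: exp_add)
    finally show ?thesis by simp
  qed
  ultimately have fail: "measure_pmf.prob (bind_pmf (D x) (\<lambda>c. E c x)) {c. \<not> ?P (Suc s) x c} \<le> exp (- L)" for x
    by (meson order_trans)
  have inv: "1 / ?l = (3 / 2) ^ s" by (simp add: power_divide)
  have "real (T1 + T2) \<le> 144005 * real T * (3 / 2) ^ s * (L + 1) + 28801 * real T * (L + 1) * (1 / ?l)"
    using D(2) T2 by simp
  \<comment> \<open>\<open>144005 + 28801 = 172806\<close>. From \<open>L\<close> at least 4,
    \<open>L + 1\<close> is at most \<open>1.25 * L\<close>, and
    \<open>172806 * 1.25 = 216007.5 = 144005 * 3 / 2\<close> reproduces the closed form.\<close>
  also have "\<dots> = (real T * (3 / 2) ^ s) * (172806 * (L + 1))"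
    unfolding inv by (simp add: algebra_simps)
  also have "\<dots> \<le> (real T * (3 / 2) ^ s) * (216007.5 * L)"
    using Suc.prems by (intro mult_left_mono) auto
  also have "\<dots> = 144005 * real T * (3 / 2) ^ Suc s * L" by simp
  finally have "real (T1 + T2) \<le> 144005 * real T * (3 / 2) ^ Suc s * L" .
  moreover have "samplable (T1 + T2) (\<lambda>x. bind_pmf (D x) (\<lambda>c. E c x))"
    by (intro samplable_bind D E)
  ultimately show ?case using fail by blast
qed

lemma estimate:
  assumes T: "realizable T (\<lambda>x. bernoulli_pmf (p x))" and p: "\<And>x. 0 \<le> p x" "\<And>x. p x \<le> 1"
    and L: "4 \<le> L" and \<epsilon>: "0 < \<epsilon>" "\<epsilon> \<le> 1"
  shows "\<exists>T' D. samplable T' D \<and> real T' \<le> 300000 * real T * L / \<epsilon> \<and>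
    (\<forall>x. measure_pmf.prob (D x) {c. \<not> \<bar>2 * p x - 1 - c\<bar> \<le> \<epsilon>} \<le> exp (- L))"
proof -
  have "\<exists>s. (2 / 3 :: real) ^ s \<le> \<epsilon>"
    using real_arch_pow_inv[of \<epsilon> "2 / 3"] \<epsilon> by (auto intro: less_imp_le)
  \<comment> \<open>For the least such \<open>s\<close>, \<open>(3 / 2) ^ s\<close> is at most 3/2
    times 1/\<epsilon>. This turns 144005 into 216007.5, rounded up to 300000.\<close>
  define s where "s = (LEAST s. (2 / 3 :: real) ^ s \<le> \<epsilon>)"
  have s: "(2 / 3 :: real) ^ s \<le> \<epsilon>" unfolding s_def by (rule LeastI_ex) fact
  have s': "(3 / 2 :: real) ^ s \<le> 3 / 2 / \<epsilon>"
  proof (cases s)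
    case 0
    thus ?thesis using \<epsilon> by (simp add: field_simps)
  next
    case (Suc s')
    have "\<not> (2 / 3 :: real) ^ s' \<le> \<epsilon>" using not_less_Least[of s' "\<lambda>s. (2 / 3 :: real) ^ s \<le> \<epsilon>"] Suc s_def by auto
    hence "(3 / 2 :: real) ^ s' \<le> 1 / \<epsilon>" using \<epsilon> by (simp add: power_divide field_simps)
    thus ?thesis using Suc \<epsilon> by (simp add: field_simps)
  qed
  from estimate_refine[OF T p L, of s] obtain T' D where D: "samplable T' D"
    "real T' \<le> 144005 * real T * (3 / 2) ^ s * L"
    "\<And>x. measure_pmf.prob (D x) {c. \<not> (\<bar>c\<bar> \<le> 1 - (2 / 3) ^ s \<and> \<bar>2 * p x - 1 - c\<bar> \<le> (2 / 3) ^ s)} \<le> exp (- L)"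
    by blast
  have "real T' \<le> 144005 * real T * (3 / 2 / \<epsilon>) * L"
    using D(2) s' L by (meson mult_left_mono mult_right_mono order_trans of_nat_0_le_iff mult_nonneg_nonneg
        zero_le_numeral)
  also have "\<dots> = (144005 * 3 / 2) * (real T * L / \<epsilon>)" by simp
  also have "\<dots> \<le> 300000 * (real T * L / \<epsilon>)" using L \<epsilon> by (intro mult_right_mono) auto
  finally have "real T' \<le> 300000 * real T * L / \<epsilon>" by simp
  moreover have "measure_pmf.prob (D x) {c. \<not> \<bar>2 * p x - 1 - c\<bar> \<le> \<epsilon>} \<le> exp (- L)" for x
    by (rule order_trans[OF measure_pmf.finite_measure_mono D(3)[of x]]) (use s in auto)
  ultimately show ?thesis using D(1) by blast
qed

end

section \<open>Splitting a probabilistic algorithm by cost\<close>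

text \<open>The support is countable, and the initial segments of an enumeration exhaust it. Finite
  sets are what \<open>realizable_mixture\<close> can handle.\<close>

lemma pmf_finite_approx:
  assumes "0 < \<eta>"
  obtains S where "finite S" "S \<subseteq> set_pmf p" "1 - \<eta> \<le> sum (pmf p) S"
proof -
  define U where "U n = from_nat_into (set_pmf p) ` {..<n}" for n :: nat
  have ne: "set_pmf p \<noteq> {}" by (rule set_pmf_not_empty)
  have U: "finite (U n)" "U n \<subseteq> set_pmf p" for n
    using from_nat_into[OF ne] by (auto simp: U_def)
  have "(\<lambda>n. measure_pmf.prob p (U n)) \<longlonglongrightarrow> measure_pmf.prob p (\<Union>n. U n)"
    by (intro measure_pmf.finite_Lim_measure_incseq) (auto simp: incseq_def U_def)
  also have "(\<Union>n. U n) = set_pmf p"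
    using U(2) from_nat_into_surj[OF countable_set_pmf[of p]] by (fastforce simp: U_def)
  also have "measure_pmf.prob p (set_pmf p) = 1"
    by (simp add: measure_pmf.prob_eq_1 AE_measure_pmf)
  finally have "eventually (\<lambda>n. 1 - \<eta> < measure_pmf.prob p (U n)) sequentially"
    by (rule order_tendstoD) (use assms in simp)
  then obtain n where "1 - \<eta> < measure_pmf.prob p (U n)"
    by (auto dest: eventually_happens simp: eventually_sequentially)
  thus ?thesis using that[of "U n"] U[of n] by (simp add: measure_measure_pmf_finite)
qed

lemma sum_pmf_le_nn_integral:
  assumes "finite S"
  shows "(\<Sum>a\<in>S. g a * ennreal (pmf p a)) \<le> (\<integral>\<^sup>+a. g a \<partial>measure_pmf p)"
proof -
  have "(\<Sum>a\<in>S. g a * ennreal (pmf p a)) = (\<integral>\<^sup>+a. g a * indicator S a \<partial>measure_pmf p)"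
    using assms by (subst nn_integral_measure_pmf_support[of S]) (auto intro!: sum.cong)
  also have "\<dots> \<le> (\<integral>\<^sup>+a. g a \<partial>measure_pmf p)"
    by (intro nn_integral_mono) (auto simp: indicator_def)
  finally show ?thesis .
qed

text \<open>Dropping algorithms from a distribution can only lower the weight of wrong
  answers.\<close>

lemma sum_pmf_le_pmf_bind:
  assumes "finite S"
  shows "(\<Sum>a\<in>S. pmf p a * pmf (g a) y) \<le> pmf (bind_pmf p g) y"
proof -
  have "ennreal (\<Sum>a\<in>S. pmf p a * pmf (g a) y) = (\<Sum>a\<in>S. ennreal (pmf (g a) y) * ennreal (pmf p a))"
    by (simp add: sum_ennreal[symmetric] ennreal_mult mult.commute)
  also have "\<dots> \<le> (\<integral>\<^sup>+a. pmf (g a) y \<partial>measure_pmf p)"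
    by (rule sum_pmf_le_nn_integral[OF assms])
  also have "\<dots> = ennreal (pmf (bind_pmf p g) y)" by (simp add: ennreal_pmf_bind)
  finally show ?thesis by (simp add: pmf_nonneg)
qed

lemma prob_neq_Some:
  "measure_pmf.prob p {y. Some y \<noteq> Some b} = pmf p (\<not> b)"
proof -
  have "{y. Some y \<noteq> Some b} = {\<not> b}" by auto
  thus ?thesis by (simp add: measure_pmf_single)
qed

section \<open>Finite mixtures and sums of estimates\<close>

context query_model begin

text \<open>Query-free coins select the component, splitting off one component at a time. The
  weights are normalized because a truncated distribution, or one level of it, may have total weight
  below 1.\<close>

lemma realizable_mixture:
  assumes "finite S" "S \<noteq> {}" "\<And>i. i \<in> S \<Longrightarrow> 0 < w i"
    and "\<And>i. i \<in> S \<Longrightarrow> realizable T (\<lambda>x. bernoulli_pmf (a i x))"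
    and "\<And>i x. i \<in> S \<Longrightarrow> 0 \<le> a i x" "\<And>i x. i \<in> S \<Longrightarrow> a i x \<le> 1"
  shows "realizable T (\<lambda>x. bernoulli_pmf ((\<Sum>i\<in>S. w i * a i x) / sum w S))"
  using assms
proof (induction S rule: finite_ne_induct)
  case (singleton i)
  have "w i \<noteq> 0" using singleton(1)[of i] by simp
  thus ?case using singleton(2)[of i] by simp
next
  case (insert i S)
  let ?W = "sum w S" and ?a = "\<lambda>x. (\<Sum>i\<in>S. w i * a i x) / sum w S"
  have W: "0 < ?W" using insert.hyps insert.prems by (intro sum_pos) auto
  have wi: "0 < w i" using insert.prems by simp
  define \<mu> where "\<mu> = w i / (w i + ?W)"
  have \<mu>: "0 \<le> \<mu>" "\<mu> \<le> 1" using W wi by (simp_all add: \<mu>_def)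
  have a: "0 \<le> ?a x" "?a x \<le> 1" for x
  proof -
    have "0 \<le> w j * a j x \<and> w j * a j x \<le> w j" if "j \<in> S" for j
      using insert.prems(1,3,4)[of j] that by (simp add: mult_left_le)
    hence "0 \<le> (\<Sum>i\<in>S. w i * a i x)" "(\<Sum>i\<in>S. w i * a i x) \<le> ?W"
      by (auto intro!: sum_nonneg sum_mono)
    thus "0 \<le> ?a x" "?a x \<le> 1" using W by simp_all
  qed
  have "realizable T (\<lambda>x. bernoulli_pmf (?a x))" by (rule insert.IH) (use insert.prems in auto)
  hence "realizable (0 + T) (\<lambda>x. bind_pmf (bernoulli_pmf \<mu>)
      (\<lambda>b. (\<lambda>b x. bernoulli_pmf (if b then a i x else ?a x)) b x))"
    using insert.prems by (intro realizable_bind realizable_bernoulli \<mu>) (case_tac b, simp_all)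
  also have "(\<lambda>x. bind_pmf (bernoulli_pmf \<mu>) (\<lambda>b. bernoulli_pmf (if b then a i x else ?a x))) =
      (\<lambda>x. bernoulli_pmf (\<mu> * a i x + (1 - \<mu>) * ?a x))"
    using a insert.prems by (intro ext, subst bind_bernoulli_pmf[OF \<mu>]) auto
  finally have "realizable T (\<lambda>x. bernoulli_pmf (\<mu> * a i x + (1 - \<mu>) * ?a x))" by simp
  moreover have "\<mu> * a i x + (1 - \<mu>) * ?a x = (\<Sum>i\<in>insert i S. w i * a i x) / sum w (insert i S)" for x
  proof -
    have "1 - \<mu> = ?W / (w i + ?W)" using W wi by (simp add: \<mu>_def field_simps)
    thus ?thesis using insert.hyps W wi by (simp add: \<mu>_def add_divide_distrib)
  qed
  ultimately show ?case by (simp only:)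
qed

text \<open>The summands are estimated one after the other; errors, failure probabilities and
  queries all add up.\<close>

lemma samplable_sum:
  fixes \<epsilon> \<delta> :: real
  assumes "finite J"
    and "\<And>j. j \<in> J \<Longrightarrow> \<exists>D. samplable (T j) D \<and>
      (\<forall>x. measure_pmf.prob (D x) {c. \<not> \<bar>g j x - c\<bar> \<le> \<epsilon>} \<le> \<delta>)"
    and \<delta>: "0 \<le> \<delta>"
  shows "\<exists>D. samplable (\<Sum>j\<in>J. T j) D \<and>
      (\<forall>x. measure_pmf.prob (D x) {c. \<not> \<bar>(\<Sum>j\<in>J. g j x) - c\<bar> \<le> real (card J) * \<epsilon>} \<le> real (card J) * \<delta>)"
  using assms(1,2)
proof (induction J rule: finite_induct)
  case empty
  have "samplable 0 (\<lambda>_. return_pmf (0 :: real))" by (rule samplable_return)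
  thus ?case by (intro exI[of _ "\<lambda>_. return_pmf (0 :: real)"]) simp
next
  case (insert j J)
  obtain D where D: "samplable (T j) D"
    "\<And>x. measure_pmf.prob (D x) {c. \<not> \<bar>g j x - c\<bar> \<le> \<epsilon>} \<le> \<delta>" using insert.prems by blast
  obtain E where E: "samplable (\<Sum>j\<in>J. T j) E"
    "\<And>x. measure_pmf.prob (E x) {c. \<not> \<bar>(\<Sum>j\<in>J. g j x) - c\<bar> \<le> real (card J) * \<epsilon>} \<le> real (card J) * \<delta>"
    using insert.IH insert.prems by blast
  let ?D = "\<lambda>x. bind_pmf (D x) (\<lambda>c. map_pmf (\<lambda>e. c + e) (E x))"
  have "samplable (T j + (\<Sum>j\<in>J. T j)) ?D"
    by (intro samplable_bind[OF D(1)] samplable_map E)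
  moreover have "measure_pmf.prob (?D x) {c. \<not> \<bar>(\<Sum>j\<in>insert j J. g j x) - c\<bar> \<le> real (card (insert j J)) * \<epsilon>} \<le>
      \<delta> + real (card J) * \<delta>" for x
  proof (intro prob_bind_pmf_le[OF D(2)[of x]])
    fix c assume c: "\<bar>g j x - c\<bar> \<le> \<epsilon>"
    let ?s = "\<Sum>j\<in>J. g j x"
    have card: "real (card (insert j J)) * \<epsilon> = \<epsilon> + real (card J) * \<epsilon>"
      using insert.hyps by (simp add: algebra_simps)
    have "measure_pmf.prob (map_pmf (\<lambda>e. c + e) (E x))
        {c. \<not> \<bar>(\<Sum>j\<in>insert j J. g j x) - c\<bar> \<le> real (card (insert j J)) * \<epsilon>} \<le>
      measure_pmf.prob (E x) {c. \<not> \<bar>?s - c\<bar> \<le> real (card J) * \<epsilon>}"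
      unfolding measure_map_pmf
    proof (intro measure_pmf.finite_measure_mono subsetI)
      fix e assume "e \<in> (\<lambda>e. c + e) -` {c. \<not> \<bar>(\<Sum>j\<in>insert j J. g j x) - c\<bar> \<le> real (card (insert j J)) * \<epsilon>}"
      hence "\<not> \<bar>g j x + ?s - (c + e)\<bar> \<le> \<epsilon> + real (card J) * \<epsilon>"
        unfolding card using insert.hyps by simp
      thus "e \<in> {c. \<not> \<bar>?s - c\<bar> \<le> real (card J) * \<epsilon>}" using c by simp
    qed simp
    also have "\<dots> \<le> real (card J) * \<delta>" by (rule E)
    finally show "measure_pmf.prob (map_pmf (\<lambda>e. c + e) (E x))
        {c. \<not> \<bar>(\<Sum>j\<in>insert j J. g j x) - c\<bar> \<le> real (card (insert j J)) * \<epsilon>} \<le> real (card J) * \<delta>" .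
  qed (use \<delta> in simp)
  moreover have "\<delta> + real (card J) * \<delta> = real (card (insert j J)) * \<delta>" using insert.hyps by (simp add: algebra_simps)
  ultimately show ?case using insert.hyps by (intro exI[of _ ?D]) simp
qed

lemma Q_le:
  assumes "samplable T D" "\<And>x b. f x = Some b \<Longrightarrow> pmf (D x) (\<not> b) \<le> 1 / 3"
  shows "Q k n f \<le> T"
proof -
  from realizable_imp_alg_output[OF realizable_samplable[OF assms(1)]] obtain A where
    A: "query_alg k n A" "queries A = T" "alg_output k n A = D" by blast
  have "computes (alg_output k n A) (1 / 3) f"
    unfolding computes_def
  proof
    fix x assume "x \<in> dom f"
    then obtain b where b: "f x = Some b" by blast
    show "measure_pmf.prob (alg_output k n A x) {y. Some y \<noteq> f x} \<le> 1 / 3"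
      unfolding b prob_neq_Some A(3) by (rule assms(2)[OF b])
  qed
  thus ?thesis unfolding Q_def using A by (intro Least_le) blast
qed

text \<open>The normalized mixture has the weighted sum divided by the weight \<open>sum w S\<close>
  as its bias. It is estimated up to \<epsilon> divided by the weight and rescaled, so a small
  weight makes the estimate cheap. If the weight is at most \<epsilon>, the answer 0 is accurate
  enough without queries.\<close>

lemma bucket_estimate:
  assumes S: "finite S" and w: "\<And>A. A \<in> S \<Longrightarrow> 0 < w A"
    and A: "\<And>A. A \<in> S \<Longrightarrow> query_alg k n A" "\<And>A. A \<in> S \<Longrightarrow> real (queries A) \<le> R"
    and R: "0 \<le> R" and \<epsilon>: "0 < \<epsilon>" and L: "4 \<le> L"
  shows "\<exists>T. real T \<le> 300000 * (R * sum w S) * L / \<epsilon> \<and> (\<exists>D. samplable T D \<and>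
    (\<forall>x. measure_pmf.prob (D x)
      {c. \<not> \<bar>(\<Sum>A\<in>S. w A * (2 * accept_prob k n A x - 1)) - c\<bar> \<le> \<epsilon>} \<le> exp (- L)))"
proof -
  let ?a = "\<lambda>A x. accept_prob k n A x"
  let ?W = "sum w S"
  let ?g = "\<lambda>x. \<Sum>A\<in>S. w A * (2 * ?a A x - 1)"
  have a: "0 \<le> ?a A x" "?a A x \<le> 1" if "A \<in> S" for A x
    using accept_prob_bounds[OF A(1)[OF that]] by simp_all
  have W: "0 \<le> ?W" using w by (intro sum_nonneg) (auto intro: less_imp_le)
  show ?thesis
  proof (cases "?W \<le> \<epsilon>")
    case True
    have "\<bar>?g x\<bar> \<le> ?W" for x
    proof -
      have "\<bar>w A * (2 * ?a A x - 1)\<bar> \<le> w A" if "A \<in> S" for A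
      proof -
        have "\<bar>2 * ?a A x - 1\<bar> \<le> 1" using a[OF that, of x] by (simp add: abs_le_iff)
        hence "\<bar>w A\<bar> * \<bar>2 * ?a A x - 1\<bar> \<le> \<bar>w A\<bar> * 1" by (intro mult_left_mono) auto
        thus ?thesis using w[OF that] by (simp add: abs_mult)
      qed
      thus ?thesis by (rule order_trans[OF sum_abs sum_mono])
    qed
    hence "\<bar>?g x\<bar> \<le> \<epsilon>" for x using True by (rule order_trans)
    hence "measure_pmf.prob (return_pmf 0) {c. \<not> \<bar>?g x - c\<bar> \<le> \<epsilon>} \<le> exp (- L)" for x
      by simp
    moreover have "real 0 \<le> 300000 * (R * ?W) * L / \<epsilon>" using R W L \<epsilon> by simp
    ultimately show ?thesis using samplable_return[of 0]
      by (intro exI[of _ 0] conjI exI[of _ "\<lambda>_. return_pmf 0"] allI)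
  next
    case False
    hence W0: "\<epsilon> < ?W" by simp
    hence W1: "0 < ?W" using \<epsilon> by simp
    hence ne: "S \<noteq> {}" by auto
    \<comment> \<open>All algorithms are padded to the same integral number of queries.\<close>
    define T where "T = nat \<lfloor>R\<rfloor>"
    have T: "real T \<le> R" using R by (simp add: T_def)
    define p where "p x = (\<Sum>A\<in>S. w A * ?a A x) / ?W" for x
    have "realizable T (\<lambda>x. bernoulli_pmf (?a A x))" if "A \<in> S" for A
    proof -
      have "queries A \<le> T" using A(2)[OF that] by (simp add: T_def le_nat_floor)
      from realizable_mono[OF realizable_alg_output[OF A(1)[OF that]] this] show ?thesis
        by (simp add: alg_output_def[abs_def])
    qed
    hence real: "realizable T (\<lambda>x. bernoulli_pmf (p x))"
      unfolding p_def using S ne w a by (intro realizable_mixture) auto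
    have p: "0 \<le> p x" "p x \<le> 1" for x
    proof -
      have "0 \<le> w A * ?a A x \<and> w A * ?a A x \<le> w A" if "A \<in> S" for A
        using w[OF that] a[OF that, of x] by (simp add: mult_left_le)
      hence "0 \<le> (\<Sum>A\<in>S. w A * ?a A x)" "(\<Sum>A\<in>S. w A * ?a A x) \<le> ?W"
        by (auto intro!: sum_nonneg sum_mono)
      thus "0 \<le> p x" "p x \<le> 1" using W1 by (simp_all add: p_def)
    qed
    have g: "?g x = ?W * (2 * p x - 1)" for x
    proof -
      have "?g x = (\<Sum>A\<in>S. 2 * (w A * ?a A x) - w A)"
        by (intro sum.cong) (simp_all add: algebra_simps)
      also have "\<dots> = 2 * (\<Sum>A\<in>S. w A * ?a A x) - ?W"
        by (simp only: sum_subtractf sum_distrib_left)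
      also have "\<dots> = ?W * (2 * p x - 1)" using W1 by (simp add: p_def right_diff_distrib)
      finally show ?thesis .
    qed
    have \<epsilon>': "0 < \<epsilon> / ?W" "\<epsilon> / ?W \<le> 1" using \<epsilon> W0 W1 by simp_all
    from estimate[OF real p L \<epsilon>'] obtain T' D where D: "samplable T' D"
      "real T' \<le> 300000 * real T * L / (\<epsilon> / ?W)"
      "\<And>x. measure_pmf.prob (D x) {c. \<not> \<bar>2 * p x - 1 - c\<bar> \<le> \<epsilon> / ?W} \<le> exp (- L)" by blast
    have "300000 * real T * L / (\<epsilon> / ?W) = real T * (300000 * ?W * L / \<epsilon>)" by simp
    also have "\<dots> \<le> R * (300000 * ?W * L / \<epsilon>)" using T W L \<epsilon> by (intro mult_right_mono) auto
    finally have cost: "real T' \<le> 300000 * (R * ?W) * L / \<epsilon>" using D(2) by (simp add: algebra_simps)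
    have "measure_pmf.prob (map_pmf (\<lambda>c. ?W * c) (D x)) {c. \<not> \<bar>?g x - c\<bar> \<le> \<epsilon>} \<le> exp (- L)" for x
    proof -
      have "\<bar>?g x - ?W * c\<bar> \<le> \<epsilon>" if "\<bar>2 * p x - 1 - c\<bar> \<le> \<epsilon> / ?W" for c
      proof -
        have "?g x - ?W * c = ?W * (2 * p x - 1 - c)" by (subst g) (simp add: right_diff_distrib)
        hence "\<bar>?g x - ?W * c\<bar> = ?W * \<bar>2 * p x - 1 - c\<bar>" using W1 by (simp add: abs_mult)
        also have "\<dots> \<le> ?W * (\<epsilon> / ?W)" using that W1 by (intro mult_left_mono) auto
        finally show ?thesis using W1 by simp
      qed
      hence "measure_pmf.prob (map_pmf (\<lambda>c. ?W * c) (D x)) {c. \<not> \<bar>?g x - c\<bar> \<le> \<epsilon>} \<le>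
          measure_pmf.prob (D x) {c. \<not> \<bar>2 * p x - 1 - c\<bar> \<le> \<epsilon> / ?W}"
        unfolding measure_map_pmf by (intro measure_pmf.finite_measure_mono) auto
      thus ?thesis using D(3)[of x] by linarith
    qed
    thus ?thesis using cost samplable_map[OF D(1), of "\<lambda>c. ?W * c"] by blast
  qed
qed

end

text \<open>The first of the budgets \<open>C\<close>, \<open>2 * C\<close>, \<open>4 * C\<close>,
  and so on, that covers the queries of \<open>A\<close>. For \<open>C = 0\<close> and an algorithm
  that makes queries there is none, and the value is meaningless.\<close>

definition cost_level :: "real \<Rightarrow> query_alg \<Rightarrow> nat" where
  "cost_level C A = (LEAST j. real (queries A) \<le> 2 ^ j * C)"

text \<open>The assumption ensures that a level exists. Above level 0 the preceding budget is too
  small, so the budget is less than twice the number of queries; level 0 has budget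
  \<open>C\<close>.\<close>

lemma cost_level:
  assumes "real (queries A) \<le> 2 ^ L * C"
  shows "cost_level C A \<le> L" "real (queries A) \<le> 2 ^ cost_level C A * C"
    "2 ^ cost_level C A * C \<le> \<bar>C\<bar> + 2 * real (queries A)"
proof -
  show "cost_level C A \<le> L" unfolding cost_level_def using assms by (rule Least_le)
  show "real (queries A) \<le> 2 ^ cost_level C A * C" unfolding cost_level_def using assms by (rule LeastI)
  show "2 ^ cost_level C A * C \<le> \<bar>C\<bar> + 2 * real (queries A)"
  proof (cases "cost_level C A")
    case (Suc j)
    hence "\<not> real (queries A) \<le> 2 ^ j * C"
      using not_less_Least[of j "\<lambda>j. real (queries A) \<le> 2 ^ j * C"] by (simp add: cost_level_def)
    thus ?thesis using Suc by simp
  qed simp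
qed

text \<open>The finite approximation loses weight at most \<eta>, and by Markov's inequality so does
  the cutoff at \<open>2 ^ L * C\<close> queries.\<close>

lemma finite_truncation:
  assumes \<eta>: "0 < \<eta>" and C: "0 \<le> C" "cost P \<le> ennreal C" and L: "1 / 2 ^ L \<le> \<eta>"
  obtains S where "finite S" "S \<subseteq> set_pmf P" "\<And>A. A \<in> S \<Longrightarrow> real (queries A) \<le> 2 ^ L * C"
    "1 - 2 * \<eta> \<le> sum (pmf P) S" "(\<Sum>A\<in>S. pmf P A * real (queries A)) \<le> C"
proof -
  obtain S where S: "finite S" "S \<subseteq> set_pmf P" "1 - \<eta> \<le> sum (pmf P) S"
    using pmf_finite_approx[OF \<eta>] .
  have cost_le: "(\<Sum>A\<in>S'. pmf P A * real (queries A)) \<le> C" if "finite S'" for S'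
  proof -
    have "ennreal (\<Sum>A\<in>S'. pmf P A * real (queries A)) =
        (\<Sum>A\<in>S'. of_nat (queries A) * ennreal (pmf P A))"
      by (simp add: sum_ennreal[symmetric] ennreal_mult mult.commute ennreal_of_nat_eq_real_of_nat)
    also have "\<dots> \<le> ennreal C"
      using sum_pmf_le_nn_integral[OF that] C(2) unfolding cost_def by (rule order_trans)
    finally show ?thesis using C(1) by simp
  qed
  define S1 where "S1 = {A \<in> S. real (queries A) \<le> 2 ^ L * C}"
  define S2 where "S2 = {A \<in> S. \<not> real (queries A) \<le> 2 ^ L * C}"
  have fin: "finite S1" "finite S2" using S by (simp_all add: S1_def S2_def)
  have "sum (pmf P) S2 \<le> 1 / 2 ^ L"
  proof (cases "C = 0")
    case True
    \<comment> \<open>Dividing by \<open>C\<close> is impossible here, but cost 0 excludes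
      algorithms in the support that make queries.\<close>
    have "S2 = {}"
    proof (rule ccontr)
      assume "S2 \<noteq> {}"
      moreover have "0 < pmf P A * real (queries A)" if "A \<in> S2" for A
        using that S(2) True by (auto simp: S2_def pmf_positive)
      ultimately have "0 < (\<Sum>A\<in>S2. pmf P A * real (queries A))" using fin by (intro sum_pos)
      thus False using cost_le[OF fin(2)] True by simp
    qed
    thus ?thesis by simp
  next
    case False
    hence C0: "0 < C" using C by simp
    have "sum (pmf P) S2 * (2 ^ L * C) \<le> (\<Sum>A\<in>S2. pmf P A * real (queries A))"
      unfolding sum_distrib_right by (intro sum_mono mult_left_mono) (auto simp: S2_def)
    also have "\<dots> \<le> C" by (rule cost_le[OF fin(2)])
    finally show ?thesis using C0 by (simp add: field_simps)
  qed
  moreover have "sum (pmf P) S = sum (pmf P) S1 + sum (pmf P) S2"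
    using S(1) by (subst sum.union_disjoint[symmetric]) (auto simp: S1_def S2_def intro!: sum.cong)
  ultimately have weight: "1 - 2 * \<eta> \<le> sum (pmf P) S1" using S(3) L by linarith
  have "S1 \<subseteq> set_pmf P" using S(2) by (auto simp: S1_def)
  thus ?thesis by (rule that[OF fin(1) _ _ weight cost_le[OF fin(1)]]) (simp add: S1_def)
qed

section \<open>The two bounds\<close>

lemma ln_3_gt_1: "1 < ln (3 :: real)"
proof -
  have "exp 1 < (3 :: real)" using e_less_272 by simp
  thus ?thesis by (metis exp_less_cancel_iff exp_ln zero_less_numeral)
qed

text \<open>\<gamma> < 1/3 keeps \<open>y = ln (1 / \<gamma>)\<close> above 1 and
  \<open>ln y\<close> above the positive constant \<open>ln (ln 3)\<close>, so additive constants
  can be absorbed into multiples of \<open>y\<close> and of \<open>ln y\<close>.\<close>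

lemma bucket_parameters:
  assumes \<gamma>: "0 < \<gamma>" "\<gamma> < 1 / 3"
  obtains L :: nat where "1 / 2 ^ L \<le> \<gamma> / 8"
    "(4 + ln (3 * (real L + 1))) * (real L + 1) \<le>
       7 * (1 + 9 / ln (ln 3)) * (ln (1 / \<gamma>) * ln (ln (1 / \<gamma>)))"
proof -
  define y where "y = ln (1 / \<gamma>)"
  have \<gamma>3: "3 \<le> 1 / \<gamma>" using \<gamma> by (simp add: field_simps)
  hence y3: "ln 3 \<le> y" unfolding y_def using \<gamma> by (subst ln_le_cancel_iff) auto
  hence y1: "1 \<le> y" using ln_3_gt_1 by simp
  define L where "L = nat \<lceil>log 2 (8 / \<gamma>)\<rceil>"
  have log8: "log 2 (8 / \<gamma>) = 3 + y / ln 2"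
  proof -
    have "ln (8 / \<gamma>) = ln (2 ^ 3 * (1 / \<gamma>))" by simp
    also have "\<dots> = 3 * ln 2 + y"
      using \<gamma> ln_realpow[of 2 3] unfolding y_def by (subst ln_mult) auto
    finally show ?thesis by (simp add: log_def add_divide_distrib)
  qed
  have ln2: "1 / 2 \<le> ln (2 :: real)" "ln (2 :: real) \<le> 1"
  proof -
    have "ln 3 \<le> ln (2 ^ 2 :: real)" by simp
    also have "\<dots> = 2 * ln (2 :: real)" using ln_realpow[of 2 2] by simp
    finally show "1 / 2 \<le> ln (2 :: real)" using ln_3_gt_1 by simp
    show "ln (2 :: real) \<le> 1" using ln_le_minus_one[of 2] by simp
  qed
  have yl: "0 \<le> y / ln 2" "y / ln 2 \<le> 2 * y"
  proof -
    show "0 \<le> y / ln 2" using y1 by simp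
    have "y * 1 \<le> y * (2 * ln 2)" using y1 ln2 by (intro mult_left_mono) auto
    thus "y / ln 2 \<le> 2 * y" using ln2 by (simp add: field_simps)
  qed
  have L: "log 2 (8 / \<gamma>) \<le> real L" "real L \<le> log 2 (8 / \<gamma>) + 1"
    unfolding L_def using yl(1) log8 by linarith+
  have "8 / \<gamma> = 2 powr (log 2 (8 / \<gamma>))" using \<gamma> by simp
  also have "\<dots> \<le> 2 powr (real L)" using L by (intro powr_mono) auto
  also have "\<dots> = 2 ^ L" by (simp add: powr_realpow)
  finally have 1: "1 / 2 ^ L \<le> \<gamma> / 8" using \<gamma> by (simp add: field_simps)
  \<comment> \<open>Rounding and the added 1 give at most \<open>5 + y / ln 2\<close>, which is at
    most \<open>5 + 2 * y\<close>.\<close>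
  have L7: "real L + 1 \<le> 7 * y" using L log8 yl y1 by linarith
  define z where "z = ln y"
  have \<kappa>: "0 < ln (ln (3 :: real))" using ln_3_gt_1 by simp
  have z: "ln (ln 3) \<le> z" unfolding z_def using y3 ln_3_gt_1 by (subst ln_le_cancel_iff) auto
  \<comment> \<open>\<open>3 * 7 = 21\<close> is rounded up to \<open>2 ^ 5\<close>;
    \<open>ln 2\<close> is at most 1, so \<open>4 + 5 = 9\<close> is the additive constant.\<close>
  have "ln (3 * (real L + 1)) \<le> ln (2 ^ 5 * y)"
    using L7 y1 by (subst ln_le_cancel_iff) auto
  also have "\<dots> = 5 * ln 2 + z"
    using y1 ln_realpow[of 2 5] unfolding z_def by (subst ln_mult) auto
  finally have "4 + ln (3 * (real L + 1)) \<le> 9 + z" using ln2 by simp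
  also have "9 \<le> 9 / ln (ln 3) * z" using \<kappa> z by (simp add: field_simps)
  finally have "4 + ln (3 * (real L + 1)) \<le> (1 + 9 / ln (ln 3)) * z"
    by (simp add: distrib_right)
  moreover have "0 \<le> (1 + 9 / ln (ln 3)) * z"  
  proof (rule mult_nonneg_nonneg)
    have "0 < 9 / ln (ln (3 :: real))" using \<kappa> by (rule divide_pos_pos[rotated]) simp
    thus "0 \<le> 1 + 9 / ln (ln (3 :: real))" by linarith
    show "0 \<le> z" using less_le_trans[OF \<kappa> z] by (rule less_imp_le)
  qed
  ultimately have "(4 + ln (3 * (real L + 1))) * (real L + 1) \<le> ((1 + 9 / ln (ln 3)) * z) * (7 * y)"
    using L7 by (intro mult_mono) auto
  hence "(4 + ln (3 * (real L + 1))) * (real L + 1) \<le> 7 * (1 + 9 / ln (ln 3)) * (y * z)"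
    by (simp add: mult_ac)
  thus ?thesis using that[OF 1] by (simp add: y_def z_def)
qed

lemma computes_pmf:
  assumes "computes F \<epsilon> f" "f x = Some b"
  shows "pmf (F x) (\<not> b) \<le> \<epsilon>"
proof -
  have "measure_pmf.prob (F x) {y. Some y \<noteq> f x} \<le> \<epsilon>"
    using assms unfolding computes_def by blast
  thus ?thesis unfolding assms(2) prob_neq_Some .
qed

section \<open>From a probabilistic algorithm to a quantum algorithm, and back\<close>

context query_model begin

lemma Q_le_cost:
  assumes P: "prob_query_alg k n P" "computes (prob_output k n P) ((1 - \<gamma>) / 2) f"
    and \<gamma>: "0 < \<gamma>" "\<gamma> < 1 / 3" and C: "0 \<le> C" "cost P \<le> ennreal C"
  shows "real (Q k n f) \<le>
    12600000 * (1 + 9 / ln (ln 3)) * (ln (1 / \<gamma>) * ln (ln (1 / \<gamma>))) * C / \<gamma>"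
proof -
  obtain L where L: "1 / 2 ^ L \<le> \<gamma> / 8"
    "(4 + ln (3 * (real L + 1))) * (real L + 1) \<le>
       7 * (1 + 9 / ln (ln 3)) * (ln (1 / \<gamma>) * ln (ln (1 / \<gamma>)))"
    using bucket_parameters[OF \<gamma>] by blast
  have \<gamma>8: "0 < \<gamma> / 8" using \<gamma> by simp
  obtain S where S: "finite S" "S \<subseteq> set_pmf P" "\<And>A. A \<in> S \<Longrightarrow> real (queries A) \<le> 2 ^ L * C"
    "1 - 2 * (\<gamma> / 8) \<le> sum (pmf P) S" "(\<Sum>A\<in>S. pmf P A * real (queries A)) \<le> C"
    using finite_truncation[OF \<gamma>8 C L(1)] by blast
  have qa: "query_alg k n A" if "A \<in> S" for A
    using P(1) S(2) that by (auto simp: prob_query_alg_def)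
  \<comment> \<open>The logarithm makes the \<open>L + 1\<close> failure probabilities add up to at
    most 1/3; the summand 4 meets the requirement of \<open>bucket_estimate\<close>.\<close>
  define N where "N = 4 + ln (3 * (real L + 1))"
  have N: "4 \<le> N" unfolding N_def by simp
  \<comment> \<open>The errors of the \<open>L + 1\<close> levels add up to \<gamma>/2.\<close>
  define \<epsilon> where "\<epsilon> = \<gamma> / (2 * (real L + 1))"
  have \<epsilon>: "0 < \<epsilon>" using \<gamma> by (simp add: \<epsilon>_def)
  define B where "B j = {A \<in> S. cost_level C A = j}" for j
  define g where "g j x = (\<Sum>A\<in>B j. pmf P A * (2 * accept_prob k n A x - 1))" for j x
  \<comment> \<open>The truncation leaves no algorithm beyond level \<open>L\<close>, so the levels
    partition \<open>S\<close>.\<close>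
  have group: "(\<Sum>j\<le>L. \<Sum>A\<in>B j. h A) = (\<Sum>A\<in>S. h A)" for h :: "query_alg \<Rightarrow> real"
    unfolding B_def using S(1) cost_level(1)[OF S(3)] by (intro sum.group) auto
  have "\<exists>T. real T \<le> 300000 * ((2 ^ j * C) * sum (pmf P) (B j)) * N / \<epsilon> \<and> (\<exists>D. samplable T D \<and>
    (\<forall>x. measure_pmf.prob (D x) {c. \<not> \<bar>g j x - c\<bar> \<le> \<epsilon>} \<le> exp (- N)))" for j
    unfolding g_def
  proof (rule bucket_estimate[OF _ _ _ _ _ \<epsilon> N])
    show "finite (B j)" using S(1) by (simp add: B_def)
    show "0 < pmf P A" if "A \<in> B j" for A using that S(2) by (auto simp: B_def pmf_positive)
    show "query_alg k n A" if "A \<in> B j" for A using that qa by (simp add: B_def)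
    show "real (queries A) \<le> 2 ^ j * C" if "A \<in> B j" for A
      using that cost_level(2)[OF S(3)[of A]] by (auto simp: B_def)
    show "0 \<le> 2 ^ j * C" using C by simp
  qed
  then obtain T where T: "\<And>j. real (T j) \<le> 300000 * ((2 ^ j * C) * sum (pmf P) (B j)) * N / \<epsilon>"
    "\<And>j. \<exists>D. samplable (T j) D \<and>
      (\<forall>x. measure_pmf.prob (D x) {c. \<not> \<bar>g j x - c\<bar> \<le> \<epsilon>} \<le> exp (- N))" by metis
  have "\<exists>D. samplable (\<Sum>j\<le>L. T j) D \<and>
      (\<forall>x. measure_pmf.prob (D x) {c. \<not> \<bar>(\<Sum>j\<le>L. g j x) - c\<bar> \<le> real (card {..L}) * \<epsilon>} \<le>
        real (card {..L}) * exp (- N))"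
    by (intro samplable_sum T(2)) simp_all
  then obtain D where D: "samplable (\<Sum>j\<le>L. T j) D"
    "\<And>x. measure_pmf.prob (D x) {c. \<not> \<bar>(\<Sum>j\<le>L. g j x) - c\<bar> \<le> real (card {..L}) * \<epsilon>} \<le>
        real (card {..L}) * exp (- N)" by blast
  have err: "real (card {..L}) * \<epsilon> = \<gamma> / 2" by (simp add: \<epsilon>_def field_simps)
  have fail: "real (card {..L}) * exp (- N) \<le> 1 / 3"
  proof -
    have "exp (- N) = exp (- 4) * exp (- ln (3 * (real L + 1)))"
      by (simp add: N_def flip: exp_add)
    hence "exp (- N) = exp (- 4) / (3 * (real L + 1))"
      by (simp add: exp_minus divide_inverse del: inverse_mult_distrib)
    moreover have "exp (- 4 :: real) \<le> 1" by simp
    ultimately show ?thesis by (simp add: field_simps)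
  qed
  \<comment> \<open>Remaining weight minus twice the remaining error: at least
    \<open>1 - \<gamma> / 4 - (1 - \<gamma>) = 3 * \<gamma> / 4\<close>.\<close>
  have bias: "(if b then 1 else - 1) * (\<Sum>j\<le>L. g j x) \<ge> 3 * \<gamma> / 4" if f: "f x = Some b" for x b
  proof -
    let ?w = "pmf P" and ?a = "\<lambda>A. accept_prob k n A x"
    have "(\<Sum>A\<in>S. ?w A * pmf (alg_output k n A x) (\<not> b)) \<le> pmf (prob_output k n P x) (\<not> b)"
      unfolding prob_output_def by (rule sum_pmf_le_pmf_bind[OF S(1)])
    also have "\<dots> \<le> (1 - \<gamma>) / 2" by (rule computes_pmf[OF P(2) f])
    finally have 1: "(\<Sum>A\<in>S. ?w A * pmf (alg_output k n A x) (\<not> b)) \<le> (1 - \<gamma>) / 2" .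
    have "(if b then 1 else - 1) * (\<Sum>j\<le>L. g j x) =
        (if b then 1 else - 1) * (\<Sum>A\<in>S. ?w A * (2 * ?a A - 1))"
      unfolding g_def group ..
    also have "\<dots> = (\<Sum>A\<in>S. ?w A - 2 * (?w A * pmf (alg_output k n A x) (\<not> b)))"
      unfolding sum_distrib_left using accept_prob_bounds[OF qa]
      by (intro sum.cong) (auto simp: alg_output_def algebra_simps)
    also have "\<dots> = sum ?w S - 2 * (\<Sum>A\<in>S. ?w A * pmf (alg_output k n A x) (\<not> b))"
      by (simp only: sum_subtractf sum_distrib_left)
    finally have 2: "(if b then 1 else - 1) * (\<Sum>j\<le>L. g j x) =
      sum ?w S - 2 * (\<Sum>A\<in>S. ?w A * pmf (alg_output k n A x) (\<not> b))" .
    have "3 * \<gamma> / 4 \<le> s - 2 * t" if "t \<le> (1 - \<gamma>) / 2" "1 - 2 * (\<gamma> / 8) \<le> s" for s t :: real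
      using that by (simp add: field_simps)
    from this[OF 1 S(4)] show ?thesis unfolding 2 .
  qed
  have Q_T: "Q k n f \<le> (\<Sum>j\<le>L. T j)"
  proof (rule Q_le[OF samplable_map[OF D(1), of "\<lambda>c. 0 < c"]])
    fix x b assume f: "f x = Some b"
    have "pmf (map_pmf (\<lambda>c. 0 < c) (D x)) (\<not> b) = measure_pmf.prob (D x) {c. (0 < c) = (\<not> b)}"
      by (simp add: pmf_map vimage_def)
    \<comment> \<open>An estimate within \<gamma>/2 of a number at distance at least
      \<open>3 * \<gamma> / 4\<close> from 0 has the right sign.\<close>
    also have "\<dots> \<le> measure_pmf.prob (D x) {c. \<not> \<bar>(\<Sum>j\<le>L. g j x) - c\<bar> \<le> real (card {..L}) * \<epsilon>}"
      unfolding err using bias[OF f] \<gamma>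
      by (intro measure_pmf.finite_measure_mono) (auto split: if_splits)
    finally show "pmf (map_pmf (\<lambda>c. 0 < c) (D x)) (\<not> b) \<le> 1 / 3"
      using D(2)[of x] fail by linarith
  qed
  have "(\<Sum>j\<le>L. \<Sum>A\<in>B j. 2 ^ j * C * pmf P A) = (\<Sum>j\<le>L. \<Sum>A\<in>B j. 2 ^ cost_level C A * C * pmf P A)"
    by (intro sum.cong refl) (simp add: B_def)
  also have "\<dots> = (\<Sum>A\<in>S. 2 ^ cost_level C A * C * pmf P A)" by (rule group)
  \<comment> \<open>Level budgets exceed twice the true query counts by at most \<open>C\<close>;
    the weights sum to at most 1 and the expected count is at most \<open>C\<close>, so the total is
    \<open>3 * C\<close>.\<close>
  also have "\<dots> \<le> (\<Sum>A\<in>S. (C + 2 * real (queries A)) * pmf P A)"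
    using cost_level(3)[OF S(3)] C(1) by (intro sum_mono mult_right_mono) auto
  also have "\<dots> = C * sum (pmf P) S + 2 * (\<Sum>A\<in>S. pmf P A * real (queries A))"
    by (simp add: sum_distrib_left sum.distrib algebra_simps)
  also have "\<dots> \<le> C * 1 + 2 * C"
    using C(1) S(1,5) by (intro add_mono mult_left_mono)
      (simp_all add: measure_measure_pmf_finite[symmetric])
  finally have total: "(\<Sum>j\<le>L. \<Sum>A\<in>B j. 2 ^ j * C * pmf P A) \<le> 3 * C" by simp
  have "real (Q k n f) \<le> (\<Sum>j\<le>L. real (T j))"
    using Q_T by (metis of_nat_le_iff of_nat_sum)
  also have "\<dots> \<le> (\<Sum>j\<le>L. 300000 * ((2 ^ j * C) * sum (pmf P) (B j)) * N / \<epsilon>)"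
    by (intro sum_mono T)
  also have "\<dots> = (300000 * N / \<epsilon>) * (\<Sum>j\<le>L. \<Sum>A\<in>B j. 2 ^ j * C * pmf P A)"
    unfolding sum_distrib_left by (simp add: sum_distrib_left sum_distrib_right sum_divide_distrib mult_ac)
  also have "\<dots> \<le> (300000 * N / \<epsilon>) * (3 * C)"
    using total N \<epsilon> by (intro mult_left_mono) auto
  \<comment> \<open>\<open>300000 * 3 * 2\<close>, the last factor from \<epsilon>; the 7 of
    \<open>bucket_parameters\<close> then gives 12600000.\<close>
  also have "\<dots> = 1800000 * C / \<gamma> * (N * (real L + 1))"
    using \<gamma> by (simp add: \<epsilon>_def field_simps)
  also have "\<dots> \<le> 1800000 * C / \<gamma> * (7 * (1 + 9 / ln (ln 3)) * (ln (1 / \<gamma>) * ln (ln (1 / \<gamma>))))"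
    using L(2) C \<gamma> unfolding N_def by (intro mult_left_mono) auto
  finally show ?thesis by (simp add: mult_ac)
qed

lemma realizable_letter:
  assumes i: "i < n" and a: "a < k"
  shows "realizable 1 (\<lambda>x. return_pmf (x ! i mod k = a))"
proof -
  let ?d = "qdim k n 1"
  have d: "0 < ?d" by (rule qdim_pos) simp
  have t: "i * k < ?d" using basis_index_less[of i n 0 k 0 1] i k_pos by (simp add: basis_index_def)
  define \<sigma> where "\<sigma> c = (if c = 0 then i * k else if c = i * k then 0 else c)" for c
  have \<sigma>: "c < ?d \<Longrightarrow> \<sigma> c < ?d \<and> \<sigma> (\<sigma> c) = c" for c using d t by (simp add: \<sigma>_def)
  define V where "V x = 1\<^sub>m ?d * (oracle_mat k n 1 x * perm_mat ?d \<sigma>)" for x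
  have V: "circuit 1 (Suc 0) V"
    unfolding V_def by (intro circuit_SucI circuit_0I unitary_perm_mat[OF \<sigma> \<sigma>]) simp
  have "col_prob ?d {i * k + a} (V x) = (if x ! i mod k = a then 1 else 0)" for x
  proof -
    let ?q = "query_answer k n x"
    have less: "map_answer k 1 ?q c < ?d" if "c < ?d" for c
      using that k_pos by (intro map_answer_less) (simp_all add: query_answer_less)
    have "V x = perm_mat ?d (map_answer k 1 ?q \<circ> \<sigma>)"
      unfolding V_def oracle_mat_perm using \<sigma> by (simp add: perm_mat_mult)
    moreover have "i * k + a < ?d"
      using basis_index_less[of i n a k 0 1] i a by (simp add: basis_index_def)
    moreover have "map_answer k 1 ?q (\<sigma> 0) = i * k + x ! i mod k"
      using i k_pos by (simp add: \<sigma>_def map_answer_def query_answer_def basis_index_def)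
    ultimately have "{i * k + a} \<inter> {..<?d} = {i * k + a}"
      "V x $$ (i * k + a, 0) = (if x ! i mod k = a then 1 else 0)" using d by auto
    thus ?thesis by (simp add: col_prob_def)
  qed
  hence "(\<lambda>x. return_pmf (x ! i mod k = a)) = (\<lambda>x. bernoulli_pmf (col_prob ?d {i * k + a} (V x)))"
    by (auto simp: fun_eq_iff bernoulli_pmf_0 bernoulli_pmf_1)
  thus ?thesis using V unfolding realizable_def realizable_at_def
    by (intro exI[of _ 1]) auto
qed

lemma samplable_letters:
  assumes "\<forall>(i, a) \<in> set ps. i < n \<and> a < k"
  shows "samplable (length ps) (\<lambda>x. return_pmf (map (\<lambda>(i, a). x ! i mod k = a) ps))"
  using assms
proof (induction ps)
  case Nil
  show ?case using samplable_return[of "[]"] by simp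
next
  case (Cons ia ps)
  obtain i a where ia: "ia = (i, a)" by (cases ia)
  have "samplable (1 + length ps) (\<lambda>x. bind_pmf (return_pmf (x ! i mod k = a))
      (\<lambda>b. map_pmf (\<lambda>bs. b # bs) (return_pmf (map (\<lambda>(i, a). x ! i mod k = a) ps))))"
    using Cons ia
    by (intro samplable_bind samplable_map samplable_realizable realizable_letter) auto
  thus ?case using ia by (simp add: bind_return_pmf)
qed

text \<open>A \<open>LEAST\<close> is meaningful only if some number qualifies. Here all
  \<open>n * k\<close> tests of a letter are made; on \<open>strings k n\<close> their results
  determine \<open>x\<close> and hence the value of \<open>f\<close>.\<close>

lemma Q_attained:
  assumes f: "dom f \<subseteq> strings k n"
  shows "\<exists>A. query_alg k n A \<and> computes (alg_output k n A) (1 / 3) f \<and> queries A = Q k n f"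
proof -
  define ps where "ps = List.product [0..<n] [0..<k]"
  define v where "v x = map (\<lambda>(i, a). x ! i mod k = a) ps" for x :: "nat list"
  have inj: "x = y" if xy: "x \<in> strings k n" "y \<in> strings k n" "v x = v y" for x y
  proof (rule nth_equalityI)
    show "length x = length y" using xy by (simp add: strings_def)
    fix i assume "i < length x"
    hence i: "i < n" using xy by (simp add: strings_def)
    have l: "x ! i < k" "y ! i < k"
      using xy i by (auto simp: strings_def subset_eq)
    have "(i, x ! i) \<in> set ps" using i l by (simp add: ps_def)
    hence "(x ! i mod k = x ! i) = (y ! i mod k = x ! i)" using xy(3) by (auto simp: v_def)
    thus "x ! i = y ! i" using l by simp
  qed
  \<comment> \<open>Decodes the vector of test results; by injectivity of \<open>v\<close> on the
    domain at most one \<open>y\<close> matches.\<close>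
  define g where "g u \<longleftrightarrow> (\<exists>y \<in> dom f. v y = u \<and> f y = Some True)" for u
  have "samplable (length ps) (\<lambda>x. return_pmf (v x))"
    unfolding v_def by (rule samplable_letters) (auto simp: ps_def)
  from realizable_samplable[OF samplable_map[OF this, of g]]
  have "realizable (length ps) (\<lambda>x. return_pmf (g (v x)))" by simp
  from realizable_imp_alg_output[OF this] obtain A where
    A: "query_alg k n A" "alg_output k n A = (\<lambda>x. return_pmf (g (v x)))" by blast
  have "f x = Some (g (v x))" if "x \<in> dom f" for x
  proof -
    have "y = x" if "y \<in> dom f" "v y = v x" for y
      using that \<open>x \<in> dom f\<close> f inj by blast
    hence "g (v x) \<longleftrightarrow> f x = Some True" unfolding g_def using that by metis
    moreover from that obtain b where "f x = Some b" by blast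
    ultimately show ?thesis by (cases b) simp_all
  qed
  hence "computes (alg_output k n A) (1 / 3) f"
    unfolding computes_def A(2) by auto
  hence "\<exists>T A. query_alg k n A \<and> computes (alg_output k n A) (1 / 3) f \<and> queries A = T"
    using A(1) by blast
  thus ?thesis unfolding Q_def by (rule LeastI_ex)
qed

text \<open>The fair coin errs with probability 1/2 and the optimal algorithm with at most 1/3, so
  the error is at most \<open>3\<gamma> / 3 + (1 - 3\<gamma>) / 2 = (1 - \<gamma>) / 2\<close>. Only
  the branch of probability \<open>3\<gamma>\<close> makes queries.\<close>

lemma PQ_le:
  assumes f: "dom f \<subseteq> strings k n" and \<gamma>: "0 < \<gamma>" "\<gamma> < 1 / 3"
  shows "PQ k n ((1 - \<gamma>) / 2) f \<le> ennreal (3 * (\<gamma> * real (Q k n f)))"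
proof -
  obtain A where A: "query_alg k n A" "computes (alg_output k n A) (1 / 3) f" "queries A = Q k n f"
    using Q_attained[OF f] by blast
  have "\<forall>b. \<exists>A. query_alg k n A \<and> queries A = 0 \<and> alg_output k n A = (\<lambda>_. return_pmf b)"
    using realizable_imp_alg_output[OF realizable_return] by blast
  then obtain A' where A': "\<And>b. query_alg k n (A' b)" "\<And>b. queries (A' b) = 0"
    "\<And>b. alg_output k n (A' b) = (\<lambda>_. return_pmf b)" by metis
  define P where "P = bind_pmf (bernoulli_pmf (3 * \<gamma>))
    (\<lambda>c. if c then return_pmf A else map_pmf A' (bernoulli_pmf (1 / 2)))"
  have \<gamma>3: "0 \<le> 3 * \<gamma>" "3 * \<gamma> \<le> 1" using \<gamma> by simp_all
  have "prob_query_alg k n P"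
    unfolding prob_query_alg_def P_def using A(1) A'(1) by (auto split: if_splits)
  moreover have "computes (prob_output k n P) ((1 - \<gamma>) / 2) f"
    unfolding computes_def
  proof
    fix x assume "x \<in> dom f"
    then obtain b where b: "f x = Some b" by blast
    have "prob_output k n P x = bind_pmf (bernoulli_pmf (3 * \<gamma>))
        (\<lambda>c. if c then alg_output k n A x else bernoulli_pmf (1 / 2))"
      unfolding prob_output_def P_def bind_assoc_pmf
      by (intro bind_pmf_cong refl) (simp add: bind_return_pmf bind_map_pmf A'(3) bind_return_pmf')
    hence "pmf (prob_output k n P x) (\<not> b) = 3 * \<gamma> * pmf (alg_output k n A x) (\<not> b) + (1 - 3 * \<gamma>) * (1 / 2)"
      using \<gamma>3 by (simp add: pmf_bind)
    also have "3 * \<gamma> * pmf (alg_output k n A x) (\<not> b) \<le> 3 * \<gamma> * (1 / 3)"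
      by (rule mult_left_mono[OF computes_pmf[OF A(2) b] \<gamma>3(1)])
    finally have "pmf (prob_output k n P x) (\<not> b) \<le> (1 - \<gamma>) / 2"
      by (simp add: field_simps)
    thus "measure_pmf.prob (prob_output k n P x) {y. Some y \<noteq> f x} \<le> (1 - \<gamma>) / 2"
      unfolding b prob_neq_Some .
  qed
  ultimately have "PQ k n ((1 - \<gamma>) / 2) f \<le> cost P"
    unfolding PQ_def by (intro Inf_lower) blast
  also have "cost P = ennreal (3 * (\<gamma> * real (Q k n f)))"
    unfolding cost_def P_def using \<gamma>3 A(3) A'(2)
    by (simp add: ennreal_of_nat_eq_real_of_nat ennreal_mult[symmetric] mult_ac)
  finally show ?thesis .
qed

text \<open>A probabilistic algorithm of infinite cost satisfies the bound trivially; otherwise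
  \<open>Q_le_cost\<close> is solved for the cost. From \<gamma> < 1/3 the iterated logarithm is
  positive, so it may be divided by.\<close>

lemma le_PQ:
  assumes \<gamma>: "0 < \<gamma>" "\<gamma> < 1 / 3"
  shows "ennreal (1 / (12600000 * (1 + 9 / ln (ln 3))) *
    (\<gamma> * real (Q k n f) / (ln (1 / \<gamma>) * ln (ln (1 / \<gamma>))))) \<le> PQ k n ((1 - \<gamma>) / 2) f"
  unfolding PQ_def
proof (intro Inf_greatest)
  fix c assume "c \<in> {cost P |P. prob_query_alg k n P \<and> computes (prob_output k n P) ((1 - \<gamma>) / 2) f}"
  then obtain P where P: "prob_query_alg k n P" "computes (prob_output k n P) ((1 - \<gamma>) / 2) f"
    and c: "c = cost P" by blast
  let ?M = "12600000 * (1 + 9 / ln (ln (3 :: real)))"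
  let ?Y = "ln (1 / \<gamma>) * ln (ln (1 / \<gamma>))"
  have "3 < 1 / \<gamma>" using \<gamma> by (simp add: field_simps)
  hence "ln 3 < ln (1 / \<gamma>)" using \<gamma> by (subst ln_less_cancel_iff) auto
  hence Y: "0 < ?Y" using ln_3_gt_1 by simp
  have M: "0 < ?M" using ln_3_gt_1 by (simp add: add_pos_pos)
  show "ennreal (1 / ?M * (\<gamma> * real (Q k n f) / ?Y)) \<le> c"
  proof (cases "cost P")
    case (real C)
    hence "real (Q k n f) \<le> ?M * ?Y * C / \<gamma>" using Q_le_cost[OF P \<gamma>, of C] by simp
    hence "\<gamma> * real (Q k n f) \<le> ?M * ?Y * C" using \<gamma> by (simp add: field_simps)
    hence "\<gamma> * real (Q k n f) / (?M * ?Y) \<le> C" using M Y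
      by (simp only: pos_divide_le_eq mult_pos_pos) (simp add: mult_ac)
    hence "1 / ?M * (\<gamma> * real (Q k n f) / ?Y) \<le> C" by simp
    thus ?thesis unfolding c using real by (simp add: ennreal_leI)
  qed (simp add: c)
qed

end

theorem theorem5p5:
  shows "\<exists>C>0::real. \<exists>c>0::real.
    \<forall>(k::nat) (n::nat) (f::nat list \<rightharpoonup> bool) (\<gamma>::real).
      k \<ge> 1 \<and> dom f \<subseteq> strings k n \<and> 0 < \<gamma> \<and> \<gamma> < 1/3 \<longrightarrow>
        PQ k n ((1 - \<gamma>) / 2) f \<le> ennreal (C * (\<gamma> * real (Q k n f))) \<and>
        ennreal (c * (\<gamma> * real (Q k n f) / (ln (1 / \<gamma>) * ln (ln (1 / \<gamma>))))) \<le> PQ k n ((1 - \<gamma>) / 2) f"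
proof (rule exI[of _ 3], rule conjI, simp, rule exI[of _ "1 / (12600000 * (1 + 9 / ln (ln 3)))"],
    intro conjI allI impI)
  show "0 < 1 / (12600000 * (1 + 9 / ln (ln (3 :: real))))"
    using ln_3_gt_1 by (simp add: add_pos_pos)
  fix k n :: nat and f :: "nat list \<rightharpoonup> bool" and \<gamma> :: real
  assume a: "k \<ge> 1 \<and> dom f \<subseteq> strings k n \<and> 0 < \<gamma> \<and> \<gamma> < 1/3"
  then interpret query_model k n by unfold_locales simp
  show "PQ k n ((1 - \<gamma>) / 2) f \<le> ennreal (3 * (\<gamma> * real (Q k n f)))"
    using a by (intro PQ_le) auto
  show "ennreal (1 / (12600000 * (1 + 9 / ln (ln 3))) *
    (\<gamma> * real (Q k n f) / (ln (1 / \<gamma>) * ln (ln (1 / \<gamma>))))) \<le> PQ k n ((1 - \<gamma>) / 2) f"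
    using a by (intro le_PQ) auto
qed

end
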